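(* Let $G$ be an SLC-group with canonical involution $*$, and let $R$ be a nonzero unital commutative ring such that $2$ is invertible in $R$. If the group ring $RG$ is $*$-clean (with respect to the $R$-linear extension of $*$), then $G\cong Q_8\times A$ for some abelian group $A$ such that: 1. $A$ has no elements of order $4$; 2. if $p$ is a prime and there is a positive integer $n$ such that $p$ divides $2^n+1$, then $A$ has no elements of order $p$. Moreover, in this case the equation $X^2+Y^2+Z^2+1=0$ has no solution $(X,Y,Z)\in R^3$.
   Context: $Q_8$ is the quaternion group of order $8$. An SLC-group is a group $G$ with $G/\mathcal Z(G)\cong C_2\times C_2$, where $\mathcal Z(G)$ is the center; then the commutator subgroup is $G'=\{1,s\}$ with $s$ central of order $2$. The canonical involution of an SLC-group is the map $*:G\to G$ with $g^*=g$ if $g\in\mathcal Z(G)$ and $g^*=sg$ if $g\notin\mathcal Z(G)$; it satisfies $(gh)^*=h^*g^*$ and $(g^* )^*=g$. It is extended $R$-linearly to the group ring $RG$ ($R$ commutative), giving a ring involution, i.e. an additive map with $(\alpha\beta)^*=\beta^*\alpha^*$ and $(\alpha^* )^*=\alpha$. A projection is an element $p$ with $p^2=p=p^*$. A unital ring with involution $*$ is $*$-clean if each of its elements is the sum of a unit and a projection. *)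

theory Defs
  imports "HOL-Algebra.Algebra" "HOL-Computational_Algebra.Primes"
begin

definition group_center :: "('g, 'm) monoid_scheme \<Rightarrow> 'g set" where
  "group_center G = {z \<in> carrier G. \<forall>g\<in>carrier G. z \<otimes>\<^bsub>G\<^esub> g = g \<otimes>\<^bsub>G\<^esub> z}"

definition SLC_group :: "('g, 'm) monoid_scheme \<Rightarrow> bool" where
  "SLC_group G \<longleftrightarrow> group G \<and>
     (G Mod group_center G) \<cong> (integer_mod_group 2 \<times>\<times> integer_mod_group 2)"

text \<open>For an SLC-group the description below determines the element: see \<open>SLC_derived\<close>
  and \<open>SLC_s_props\<close>.\<close>

definition SLC_s :: "('g, 'm) monoid_scheme \<Rightarrow> 'g" where
  "SLC_s G = (THE s. s \<noteq> \<one>\<^bsub>G\<^esub> \<and> derived G (carrier G) = {\<one>\<^bsub>G\<^esub>, s})"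

definition canonical_involution :: "('g, 'm) monoid_scheme \<Rightarrow> 'g \<Rightarrow> 'g" where
  "canonical_involution G g = (if g \<in> group_center G then g else SLC_s G \<otimes>\<^bsub>G\<^esub> g)"

text \<open>An element \<open>\<Sum> f(g) g\<close> of the group ring is represented by its coefficient function \<open>f\<close>,
  finitely supported on the carrier of the group and \<open>undefined\<close> outside it.\<close>

definition grsupp ::
    "('r, 'm) ring_scheme \<Rightarrow> ('g, 'n) monoid_scheme \<Rightarrow> ('g \<Rightarrow> 'r) \<Rightarrow> 'g set" where
  "grsupp R G f = {g \<in> carrier G. f g \<noteq> \<zero>\<^bsub>R\<^esub>}"

definition group_ring ::
    "('r, 'm) ring_scheme \<Rightarrow> ('g, 'n) monoid_scheme \<Rightarrow> ('g \<Rightarrow> 'r) ring" where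
  "group_ring R G =
     \<lparr>carrier = {f \<in> carrier G \<rightarrow>\<^sub>E carrier R. finite (grsupp R G f)},
      monoid.mult = (\<lambda>f h. \<lambda>x\<in>carrier G.
        (\<Oplus>\<^bsub>R\<^esub>y\<in>grsupp R G f. f y \<otimes>\<^bsub>R\<^esub> h (inv\<^bsub>G\<^esub> y \<otimes>\<^bsub>G\<^esub> x))),
      monoid.one = (\<lambda>x\<in>carrier G. if x = \<one>\<^bsub>G\<^esub> then \<one>\<^bsub>R\<^esub> else \<zero>\<^bsub>R\<^esub>),
      ring.zero = (\<lambda>x\<in>carrier G. \<zero>\<^bsub>R\<^esub>),
      ring.add = (\<lambda>f h. \<lambda>x\<in>carrier G. f x \<oplus>\<^bsub>R\<^esub> h x)\<rparr>"

text \<open>The linear extension of a map \<open>\<sigma>\<close> on the group sends \<open>\<Sum> f(g) g\<close> to \<open>\<Sum> f(g) \<sigma>(g)\<close>;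
  the coefficient of \<open>x\<close> in the latter collects all \<open>g\<close> with \<open>\<sigma>(g) = x\<close>.\<close>

definition linear_extension ::
    "('r, 'm) ring_scheme \<Rightarrow> ('g, 'n) monoid_scheme \<Rightarrow> ('g \<Rightarrow> 'g) \<Rightarrow> ('g \<Rightarrow> 'r) \<Rightarrow> ('g \<Rightarrow> 'r)" where
  "linear_extension R G \<sigma> f =
     (\<lambda>x\<in>carrier G. (\<Oplus>\<^bsub>R\<^esub>g\<in>{g \<in> grsupp R G f. \<sigma> g = x}. f g))"

definition is_projection :: "('a, 'm) ring_scheme \<Rightarrow> ('a \<Rightarrow> 'a) \<Rightarrow> 'a \<Rightarrow> bool" where
  "is_projection S star p \<longleftrightarrow> p \<in> carrier S \<and> p \<otimes>\<^bsub>S\<^esub> p = p \<and> star p = p"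

definition star_clean :: "('a, 'm) ring_scheme \<Rightarrow> ('a \<Rightarrow> 'a) \<Rightarrow> bool" where
  "star_clean S star \<longleftrightarrow>
     (\<forall>a\<in>carrier S. \<exists>u\<in>Units S. \<exists>p. is_projection S star p \<and> a = u \<oplus>\<^bsub>S\<^esub> p)"

text \<open>The tuple \<open>(a, b, c, d)\<close> stands for \<open>a + b i + c j + d k\<close>, and \<open>Q8\<close> is
  \<open>{\<plusminus>1, \<plusminus>i, \<plusminus>j, \<plusminus>k}\<close> under Hamilton's product.\<close>

fun hamilton_mult ::
    "int \<times> int \<times> int \<times> int \<Rightarrow> int \<times> int \<times> int \<times> int \<Rightarrow> int \<times> int \<times> int \<times> int" where
  "hamilton_mult (a, b, c, d) (a', b', c', d') =
     (a * a' - b * b' - c * c' - d * d',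
      a * b' + b * a' + c * d' - d * c',
      a * c' - b * d' + c * a' + d * b',
      a * d' + b * c' - c * b' + d * a')"

definition Q8 :: "(int \<times> int \<times> int \<times> int) monoid" where
  "Q8 = \<lparr>carrier = {(1, 0, 0, 0), (-1, 0, 0, 0), (0, 1, 0, 0), (0, -1, 0, 0),
                    (0, 0, 1, 0), (0, 0, -1, 0), (0, 0, 0, 1), (0, 0, 0, -1)},
         monoid.mult = hamilton_mult, monoid.one = (1, 0, 0, 0)\<rparr>"

lemma group_Q8: "group Q8"
proof (rule groupI)
  fix x y z assume "x \<in> carrier Q8" "y \<in> carrier Q8" "z \<in> carrier Q8"
  show "x \<otimes>\<^bsub>Q8\<^esub> y \<otimes>\<^bsub>Q8\<^esub> z = x \<otimes>\<^bsub>Q8\<^esub> (y \<otimes>\<^bsub>Q8\<^esub> z)"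
    by (cases x; cases y; cases z) (simp add: Q8_def algebra_simps)
qed (auto simp: Q8_def)

lemma normal_group_center:
  fixes G (structure)
  assumes "group G"
  shows "group_center G \<lhd> G"
proof -
  interpret group G by fact
  have sub: "subgroup (group_center G) G"
  proof (rule subgroupI)
    show "group_center G \<noteq> {}" by (auto simp: group_center_def intro!: exI[of _ \<one>])
  next
    fix a assume "a \<in> group_center G"
    then have a: "a \<in> carrier G" "\<And>g. g \<in> carrier G \<Longrightarrow> a \<otimes> g = g \<otimes> a"
      by (auto simp: group_center_def)
    have "inv a \<otimes> g = g \<otimes> inv a" if g: "g \<in> carrier G" for g
      using a(1) a(2)[OF g] g by (metis inv_closed inv_solve_left inv_solve_right m_assoc m_closed)
    then show "inv a \<in> group_center G" using a(1) by (auto simp: group_center_def)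
  next
    fix a b assume "a \<in> group_center G" "b \<in> group_center G"
    then have a: "a \<in> carrier G" "\<And>g. g \<in> carrier G \<Longrightarrow> a \<otimes> g = g \<otimes> a"
      and b: "b \<in> carrier G" "\<And>g. g \<in> carrier G \<Longrightarrow> b \<otimes> g = g \<otimes> b"
      by (auto simp: group_center_def)
    have "a \<otimes> b \<otimes> g = g \<otimes> (a \<otimes> b)" if g: "g \<in> carrier G" for g
      using a(1) b(1) a(2)[OF g] b(2)[OF g] g by (metis m_assoc)
    then show "a \<otimes> b \<in> group_center G" using a(1) b(1) by (auto simp: group_center_def)
  qed (auto simp: group_center_def)
  show ?thesis
    unfolding normal_inv_iff
  proof (intro conjI ballI sub)
    fix x h assume x: "x \<in> carrier G" and h: "h \<in> group_center G"
    then have hh: "h \<in> carrier G" "h \<otimes> x = x \<otimes> h" by (auto simp: group_center_def)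
    have "x \<otimes> h \<otimes> inv x = h" using x hh by (metis inv_solve_right m_closed)
    then show "x \<otimes> h \<otimes> inv x \<in> group_center G" using h by simp
  qed
qed

theorem SLC_derived:
  fixes G (structure)
  assumes "SLC_group G"
  shows "\<exists>!s. s \<noteq> \<one>\<^bsub>G\<^esub> \<and> derived G (carrier G) = {\<one>\<^bsub>G\<^esub>, s}"
    and "\<exists>s. s \<noteq> \<one>\<^bsub>G\<^esub> \<and> derived G (carrier G) = {\<one>\<^bsub>G\<^esub>, s} \<and> s \<in> group_center G \<and> s \<otimes>\<^bsub>G\<^esub> s = \<one>\<^bsub>G\<^esub>"
proof -
  interpret group G using assms by (simp add: SLC_group_def)
  define Z where "Z = group_center G"
  define V where "V = integer_mod_group 2 \<times>\<times> integer_mod_group 2"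
  interpret Z: normal Z G using normal_group_center[OF is_group] by (simp add: Z_def)
  have Zc: "z \<otimes> g = g \<otimes> z" if "z \<in> Z" "g \<in> carrier G" for z g
    using that unfolding Z_def group_center_def by blast
  have Zcar: "z \<in> carrier G" if "z \<in> Z" for z using that Z.subset by auto
  have ZI: "z \<in> Z" if "z \<in> carrier G" "\<And>g. g \<in> carrier G \<Longrightarrow> z \<otimes> g = g \<otimes> z" for z
    using that unfolding Z_def group_center_def by blast
  obtain \<phi> where \<phi>: "\<phi> \<in> iso (G Mod Z) V"
    using assms by (auto simp: SLC_group_def is_iso_def Z_def V_def)
  have Vcar: "carrier V = {0,1} \<times> {0,1}"
    by (auto simp: V_def DirProd_def carrier_integer_mod_group)
  define f where "f x = \<phi> (Z #> x)" for x
  have cos: "Z #> x \<in> carrier (G Mod Z)" if "x \<in> carrier G" for x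
    using that by (auto simp: FactGroup_def RCOSETS_def)
  have fcar: "f x \<in> {0,1} \<times> {0,1}" if "x \<in> carrier G" for x
    using \<phi> cos[OF that] unfolding f_def iso_def hom_def Vcar by auto
  have fmult: "f (x \<otimes> y) = f x \<otimes>\<^bsub>V\<^esub> f y" if "x \<in> carrier G" "y \<in> carrier G" for x y
  proof -
    have "Z #> (x \<otimes> y) = (Z #> x) \<otimes>\<^bsub>G Mod Z\<^esub> (Z #> y)"
      using that by (simp add: FactGroup_def Z.rcos_sum)
    then show ?thesis using \<phi> cos that unfolding f_def iso_def hom_def by auto
  qed
  have finj: "Z #> x = Z #> y" if "x \<in> carrier G" "y \<in> carrier G" "f x = f y" for x y
    using \<phi> cos that unfolding f_def iso_def bij_betw_def inj_on_def by auto
  have fsurj: "\<exists>x\<in>carrier G. f x = v" if v: "v \<in> {0,1} \<times> {0,1}" for v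
  proof -
    have "v \<in> \<phi> ` carrier (G Mod Z)"
      using \<phi> v unfolding iso_def bij_betw_def Vcar by auto
    then show ?thesis by (auto simp: f_def FactGroup_def RCOSETS_def)
  qed
  have coset: "\<exists>z\<in>Z. x = z \<otimes> y" if "x \<in> carrier G" "y \<in> carrier G" "f x = f y" for x y
  proof -
    have "x \<in> Z #> y" using rcos_self[OF that(1) Z.is_subgroup] finj[OF that] by simp
    then show ?thesis by (auto simp: r_coset_def)
  qed
  obtain a where a: "a \<in> carrier G" "f a = (1,0)" using fsurj[of "(1,0)"] by auto
  obtain b where b: "b \<in> carrier G" "f b = (0,1)" using fsurj[of "(0,1)"] by auto
  have fab: "f (a \<otimes> b) = (1,1)" using fmult[OF a(1) b(1)] a b by (simp add: V_def DirProd_def)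
  have faa: "f (a \<otimes> a) = (0,0)" using fmult[OF a(1) a(1)] a by (simp add: V_def DirProd_def)
  have fbaab: "f (b \<otimes> a) = f (a \<otimes> b)"
    using fmult[OF b(1) a(1)] fab a b by (simp add: V_def DirProd_def)
  have f1: "f \<one> = (0,0)"
    using fmult[OF one_closed one_closed] fcar[OF one_closed] by (auto simp: V_def DirProd_def)
  have cover: "\<exists>z\<in>Z. x = z \<or> x = z \<otimes> a \<or> x = z \<otimes> b \<or> x = z \<otimes> (a \<otimes> b)" if x: "x \<in> carrier G" for x
  proof -
    have "f x = (0,0) \<or> f x = (1,0) \<or> f x = (0,1) \<or> f x = (1,1)" using fcar[OF x] by auto
    then have "(\<exists>z\<in>Z. x = z \<otimes> \<one>) \<or> (\<exists>z\<in>Z. x = z \<otimes> a) \<or> (\<exists>z\<in>Z. x = z \<otimes> b) \<or> (\<exists>z\<in>Z. x = z \<otimes> (a \<otimes> b))"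
      using coset[OF x one_closed] coset[OF x a(1)] coset[OF x b(1)]
        coset[OF x m_closed[OF a(1) b(1)]] f1 a b fab by metis
    then show ?thesis by (metis Zcar r_one)
  qed
  have a2: "a \<otimes> a \<in> Z" using coset[of "a \<otimes> a" \<one>] faa f1 a by (metis Zcar m_closed one_closed r_one)
  obtain c where c: "c \<in> Z" "a \<otimes> b = c \<otimes> (b \<otimes> a)"
    using coset[of "a \<otimes> b" "b \<otimes> a"] a b fbaab by auto
  have cG: "c \<in> carrier G" using c Zcar by simp
  have c2: "c \<otimes> c = \<one>"
  proof -
    have "b \<otimes> (a \<otimes> a) = (a \<otimes> a) \<otimes> b" using Zc[OF a2 b(1)] by simp
    also have "\<dots> = a \<otimes> (c \<otimes> (b \<otimes> a))" unfolding c(2)[symmetric] using a(1) b(1) by (simp add: m_assoc)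
    also have "\<dots> = (a \<otimes> c) \<otimes> (b \<otimes> a)" using a(1) b(1) cG by (simp add: m_assoc)
    also have "\<dots> = c \<otimes> (a \<otimes> b \<otimes> a)"
      unfolding Zc[OF c(1) a(1), symmetric] using a(1) b(1) cG by (simp add: m_assoc)
    also have "\<dots> = c \<otimes> c \<otimes> (b \<otimes> (a \<otimes> a))"
      unfolding c(2) using a(1) b(1) cG by (simp add: m_assoc)
    finally have eq: "b \<otimes> (a \<otimes> a) = c \<otimes> c \<otimes> (b \<otimes> (a \<otimes> a))" .
    have "b \<otimes> (a \<otimes> a) \<in> carrier G" "c \<otimes> c \<in> carrier G" using a(1) b(1) cG by auto
    from r_cancel_one'[OF this] eq show ?thesis by blast
  qed
  define P where "P x y \<longleftrightarrow> x \<otimes> y = y \<otimes> x \<or> x \<otimes> y = c \<otimes> (y \<otimes> x)" for x y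
  have Psym: "P y x" if "P x y" "x \<in> carrier G" "y \<in> carrier G" for x y
  proof (cases "x \<otimes> y = y \<otimes> x")
    case False
    then have *: "x \<otimes> y = c \<otimes> (y \<otimes> x)" using that(1) by (simp add: P_def)
    have "c \<otimes> (x \<otimes> y) = (c \<otimes> c) \<otimes> (y \<otimes> x)" unfolding * using that cG by (simp add: m_assoc)
    then have "y \<otimes> x = c \<otimes> (x \<otimes> y)" using that c2 by simp
    then show ?thesis by (simp only: P_def simp_thms)
  qed (simp only: P_def simp_thms)
  have Pmult: "P (x \<otimes> y) w" if P: "P x w" "P y w"
    and xyw: "x \<in> carrier G" "y \<in> carrier G" "w \<in> carrier G" for x y w
  proof -
    obtain d where d: "d = \<one> \<or> d = c" "x \<otimes> w = d \<otimes> (w \<otimes> x)"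
      using P(1) xyw unfolding P_def by (metis l_one m_closed)
    obtain e where e: "e = \<one> \<or> e = c" "y \<otimes> w = e \<otimes> (w \<otimes> y)"
      using P(2) xyw unfolding P_def by (metis l_one m_closed)
    have dG: "d \<in> carrier G" and eG: "e \<in> carrier G" using d e cG by auto
    have ex: "e \<otimes> x = x \<otimes> e"
      using e(1) Zc[OF c(1) xyw(1)] xyw(1) by (elim disjE) simp_all
    have "x \<otimes> y \<otimes> w = x \<otimes> (e \<otimes> (w \<otimes> y))"
      unfolding e(2)[symmetric] using xyw by (rule m_assoc)
    also have "\<dots> = (x \<otimes> e) \<otimes> (w \<otimes> y)" using xyw eG by (simp add: m_assoc)
    also have "\<dots> = e \<otimes> ((x \<otimes> w) \<otimes> y)"
      unfolding ex[symmetric] using xyw eG by (simp add: m_assoc)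
    also have "\<dots> = (e \<otimes> d) \<otimes> (w \<otimes> (x \<otimes> y))"
      unfolding d(2) using xyw eG dG by (simp add: m_assoc)
    finally have *: "x \<otimes> y \<otimes> w = (e \<otimes> d) \<otimes> (w \<otimes> (x \<otimes> y))" .
    have "e \<otimes> d = \<one> \<or> e \<otimes> d = c" using d(1) e(1) c2 cG by auto
    then show ?thesis using * xyw unfolding P_def by auto
  qed
  have PZ: "P z w" if "z \<in> Z" "w \<in> carrier G" for z w using Zc[OF that] by (simp only: P_def simp_thms)
  have Pall1: "P x w" if "P a w" "P b w" "x \<in> carrier G" "w \<in> carrier G" for x w
    using cover[OF that(3)] that a b Zcar PZ Pmult by (metis m_closed)
  have Paa: "P a a" "P b b" "P a b" by (auto simp: P_def c(2))
  have Pba: "P b a" using Psym Paa a b by blast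
  have Pall: "P x y" if "x \<in> carrier G" "y \<in> carrier G" for x y
    using Pall1 Psym Paa Pba a b that by meson
  have cn1: "c \<noteq> \<one>"
  proof
    assume "c = \<one>"
    then have ab: "a \<otimes> b = b \<otimes> a" using c a b by simp
    have "a \<otimes> x = x \<otimes> a" if x: "x \<in> carrier G" for x
    proof -
      obtain z where z: "z \<in> Z" "x = z \<or> x = z \<otimes> a \<or> x = z \<otimes> b \<or> x = z \<otimes> (a \<otimes> b)"
        using cover[OF x] by auto
      note zz = Zcar[OF z(1)] Zc[OF z(1) a(1)]
      from z(2) show ?thesis using zz ab a b by (metis m_assoc m_closed)
    qed
    then have "a \<in> Z" using ZI a by blast
    then have "Z #> a = Z #> \<one>" using a Z.rcos_const[of a] coset_mult_one[OF Z.subset] by simp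
    then show False using a f1 by (simp add: f_def)
  qed
  have subc: "subgroup {\<one>, c} G"
    using cG c2 inv_equality[OF c2 cG cG] by (intro subgroupI) auto
  have commc: "x \<otimes> y \<otimes> inv x \<otimes> inv y \<in> {\<one>, c}" if "x \<in> carrier G" "y \<in> carrier G" for x y
  proof -
    have "x \<otimes> y = \<one> \<otimes> (y \<otimes> x) \<or> x \<otimes> y = c \<otimes> (y \<otimes> x)"
      using Pall[OF that] that by (auto simp: P_def)
    then obtain d where d: "d \<in> {\<one>, c}" "x \<otimes> y = d \<otimes> (y \<otimes> x)" by blast
    have "x \<otimes> y \<otimes> inv x \<otimes> inv y = d"
      using d that cG by (metis inv_solve_right insertE inv_closed m_assoc m_closed one_closed singletonD)
    then show ?thesis using d by simp
  qed
  have "c = a \<otimes> b \<otimes> inv a \<otimes> inv b"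
    using c(2) a b cG by (metis inv_solve_right m_assoc m_closed inv_closed)
  then have "c \<in> derived_set G (carrier G)" using a b by blast
  then have "{\<one>, c} \<subseteq> derived G (carrier G)"
    unfolding derived_def by (auto intro: generate.one generate.incl)
  moreover have "derived G (carrier G) \<subseteq> {\<one>, c}"
    unfolding derived_def using commc by (intro generate_subgroup_incl[OF _ subc]) blast
  ultimately have der: "derived G (carrier G) = {\<one>, c}" by auto
  show "\<exists>!s. s \<noteq> \<one> \<and> derived G (carrier G) = {\<one>, s}"
    using der cn1 by (intro ex1I[of _ c]) auto
  show "\<exists>s. s \<noteq> \<one> \<and> derived G (carrier G) = {\<one>, s} \<and> s \<in> group_center G \<and> s \<otimes> s = \<one>"
    using der cn1 c(1) c2 by (auto simp: Z_def)
qed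

corollary SLC_s_props:
  assumes "SLC_group G"
  shows "SLC_s G \<noteq> \<one>\<^bsub>G\<^esub>" "derived G (carrier G) = {\<one>\<^bsub>G\<^esub>, SLC_s G}"
    "SLC_s G \<in> group_center G" "SLC_s G \<otimes>\<^bsub>G\<^esub> SLC_s G = \<one>\<^bsub>G\<^esub>"
proof -
  obtain s where s: "s \<noteq> \<one>\<^bsub>G\<^esub>" "derived G (carrier G) = {\<one>\<^bsub>G\<^esub>, s}" "s \<in> group_center G"
    "s \<otimes>\<^bsub>G\<^esub> s = \<one>\<^bsub>G\<^esub>"
    using SLC_derived(2)[OF assms] by blast
  have "SLC_s G = s"
    unfolding SLC_s_def using SLC_derived(1)[OF assms] s by (intro the1_equality) auto
  with s show "SLC_s G \<noteq> \<one>\<^bsub>G\<^esub>" "derived G (carrier G) = {\<one>\<^bsub>G\<^esub>, SLC_s G}"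
    "SLC_s G \<in> group_center G" "SLC_s G \<otimes>\<^bsub>G\<^esub> SLC_s G = \<one>\<^bsub>G\<^esub>" by simp_all
qed

end

theory Submission
  imports Defs
begin

text \<open>
  An element of \<open>RG\<close> fixed by the involution takes equal values at \<open>g\<close> and \<open>s g\<close> for every
  noncentral \<open>g\<close>; since every conjugate of such a \<open>g\<close> is \<open>g\<close> or \<open>s g\<close>, the element is central
  (\<open>symmetric_central\<close>). Hence a \<open>*\<close>-clean \<open>RG\<close> consists of sums of a unit and a \<^emph>\<open>central\<close>
  idempotent. If the image \<open>e\<close> of such a sum \<open>u + p\<close> in a quotient ring is idempotent, then
  \<open>(e - p)(1 - e - p) = 0\<close> and \<open>e - p = u\<close> is a unit, so \<open>e = 1 - p\<close> is central. In
  every quotient \<open>T\<close> of \<open>RG\<close> all idempotents, and as \<open>2\<close> is invertible all square roots of \<open>1\<close>,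
  are therefore central. Noncentral square roots of \<open>1\<close> in well-chosen quotients then exclude
  everything that the theorem excludes.

  The quotients come from class functions \<open>w : G \<rightarrow> R\<close> with possibly infinite support. The group
  ring acts on all functions \<open>G \<rightarrow> R\<close> by convolution, and the annihilator of a nonzero class
  function is a proper two-sided ideal (\<open>ideal_annihilator\<close>). If \<open>w(s x) = - w(x)\<close>, then \<open>s\<close>
  becomes \<open>-1\<close> in the quotient, so that group elements which do not commute anticommute there.

  \<^item> If \<open>g\<close> is noncentral and \<open>s\<close> is not a power of \<open>g\<^sup>2\<close>, take \<open>w\<close> equal to \<open>1\<close> on
    \<open>N = \<langle>g\<^sup>2\<rangle>\<close>, to \<open>-1\<close> on \<open>s N\<close> and to \<open>0\<close> elsewhere. In the quotient \<open>g\<close> is a square root of \<open>1\<close>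
    that anticommutes with a unit, which is impossible. So \<open>s\<close> is a power of \<open>g\<^sup>2\<close> for every
    noncentral \<open>g\<close> (\<open>s_in_square_powers\<close>).
  \<^item> This property is a strong restriction on \<open>G\<close>. It gives noncommuting \<open>a, b\<close> with
    \<open>a\<^sup>2 = b\<^sup>2 = s\<close> (\<open>quaternion_generators\<close>), it shows that \<open>s\<close> is not the square of a central element,
    so that \<open>Z(G) = \<langle>s\<rangle> \<times> A\<close> (\<open>center_complement\<close>) and \<open>G \<cong> Q\<^sub>8 \<times> A\<close>, and it excludes central
    elements of order \<open>4\<close>.
  \<^item> If \<open>x, y, z\<close> are central in \<open>RG\<close> and \<open>x\<^sup>2 + y\<^sup>2 + z\<^sup>2 + 1\<close> annihilates a \<open>w\<close> as above, then
    \<open>x a + y b + z a b\<close> is a square root of \<open>1\<close> in the quotient, and its centrality forces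
    \<open>1 = 0\<close> there, so that \<open>w = 0\<close> (\<open>three_squares_anisotropic\<close>). With \<open>w = 1 - s\<close> this proves that \<open>X\<^sup>2 + Y\<^sup>2 + Z\<^sup>2 + 1 = 0\<close>
    has no solution in \<open>R\<close>.
  \<^item> If \<open>d\<close> is central with \<open>d\<close> to the power \<open>2\<^sup>n + 1\<close> equal to \<open>1\<close>, telescoping gives
    \<open>(1 - d\<^sup>2) \<Prod> (1 + (d\<^sup>2)\<^sup>m) = - d\<^bsup>-2\<^esup> (1 - d\<^sup>2)\<close>, the product running over \<open>m = 1, 2, 4, ..., 2\<^bsup>n-1\<^esup>\<close>.
    Each factor is a sum of two squares, hence so is the product, and multiplying by
    \<open>d\<^sup>2\<close> yields \<open>x, y\<close> in \<open>R\<langle>d\<rangle>\<close> with \<open>(1 - d\<^sup>2) (x\<^sup>2 + y\<^sup>2 + 1) = 0\<close>. The previous argument with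
    \<open>w = (1 - d\<^sup>2) (1 - s)\<close> gives \<open>d\<^sup>2 = 1\<close> (\<open>center_pow_two_pow_plus_one\<close>), which excludes the
    primes in the theorem as element orders.\<close>

section \<open>Rings whose idempotents are central\<close>

definition idempotents_central :: "('a, 'm) ring_scheme \<Rightarrow> bool" where
  "idempotents_central R \<longleftrightarrow>
     (\<forall>e\<in>carrier R. e \<otimes>\<^bsub>R\<^esub> e = e \<longrightarrow> (\<forall>y\<in>carrier R. e \<otimes>\<^bsub>R\<^esub> y = y \<otimes>\<^bsub>R\<^esub> e))"

text \<open>What remains of \<open>*\<close>-cleanness once projections are known to be central. The involution,
  which quotients need not inherit, has disappeared.\<close>
definition centrally_clean :: "('a, 'm) ring_scheme \<Rightarrow> bool" where
  "centrally_clean R \<longleftrightarrow>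
     (\<forall>x\<in>carrier R. \<exists>u\<in>Units R. \<exists>p\<in>carrier R.
        p \<otimes>\<^bsub>R\<^esub> p = p \<and> (\<forall>y\<in>carrier R. p \<otimes>\<^bsub>R\<^esub> y = y \<otimes>\<^bsub>R\<^esub> p) \<and> x = u \<oplus>\<^bsub>R\<^esub> p)"

text \<open>Two commuting idempotents satisfy \<open>(x - p) (1 - x - p) = 0\<close>, and here \<open>x - p\<close> can be
  cancelled.\<close>
lemma (in ring) idempotent_eq_complement:
  assumes x: "x \<in> carrier R" "x \<otimes> x = x" and p: "p \<in> carrier R" "p \<otimes> p = p"
    and comm: "p \<otimes> x = x \<otimes> p" and unit: "u \<in> Units R" and sum: "x = u \<oplus> p"
  shows "x = \<one> \<ominus> p"
proof -
  have u: "u \<in> carrier R" "u = x \<ominus> p"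
    using unit sum p by (auto simp: Units_def) algebra
  have "u \<otimes> (\<one> \<ominus> x \<ominus> p) = (x \<ominus> x \<otimes> x) \<ominus> (p \<ominus> p \<otimes> p) \<oplus> (p \<otimes> x \<ominus> x \<otimes> p)"
    unfolding u(2) using x(1) p(1) by (algebra; simp add: a_ac)
  also have "\<dots> = \<zero>"
    using x p comm by (simp add: r_neg minus_eq)
  finally have "u \<otimes> (\<one> \<ominus> x \<ominus> p) = u \<otimes> \<zero>" using u(1) by simp
  then have "\<one> \<ominus> x \<ominus> p = \<zero>"
    using Units_l_cancel[OF unit] x p by simp
  moreover have "\<one> \<ominus> p = (\<one> \<ominus> x \<ominus> p) \<oplus> x" using x p by algebra
  ultimately show ?thesis using x by simp
qed

lemma idempotents_central_image:
  assumes hom: "ring_hom_ring R S h" and surj: "h ` carrier R = carrier S"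
    and clean: "centrally_clean R"
  shows "idempotents_central S"
  unfolding idempotents_central_def
proof (intro ballI impI)
  interpret ring_hom_ring R S h by fact
  fix e y assume e: "e \<in> carrier S" "e \<otimes>\<^bsub>S\<^esub> e = e" and y: "y \<in> carrier S"
  obtain x where x: "x \<in> carrier R" "h x = e" using surj e(1) by (metis imageE)
  obtain u p where up: "u \<in> Units R" "p \<in> carrier R" "p \<otimes>\<^bsub>R\<^esub> p = p"
      "\<And>y. y \<in> carrier R \<Longrightarrow> p \<otimes>\<^bsub>R\<^esub> y = y \<otimes>\<^bsub>R\<^esub> p" "x = u \<oplus>\<^bsub>R\<^esub> p"
    using clean x(1) unfolding centrally_clean_def by metis
  have cen: "h p \<otimes>\<^bsub>S\<^esub> z = z \<otimes>\<^bsub>S\<^esub> h p" if z: "z \<in> carrier S" for z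
  proof -
    obtain z' where "z' \<in> carrier R" "h z' = z" using surj z by (metis imageE)
    then show ?thesis using up(2) up(4)[of z'] by (metis hom_mult)
  qed
  obtain v where v: "v \<in> carrier R" "u \<in> carrier R" "u \<otimes>\<^bsub>R\<^esub> v = \<one>\<^bsub>R\<^esub>" "v \<otimes>\<^bsub>R\<^esub> u = \<one>\<^bsub>R\<^esub>"
    using up(1) by (auto simp: Units_def)
  have "h u \<in> Units S"
    unfolding Units_def using v by (auto simp flip: hom_mult intro!: bexI[of _ "h v"])
  then have "e = \<one>\<^bsub>S\<^esub> \<ominus>\<^bsub>S\<^esub> h p"
    using S.idempotent_eq_complement[of e "h p" "h u"] e up x cen v(2)
    by (metis hom_add hom_closed hom_mult)
  then show "e \<otimes>\<^bsub>S\<^esub> y = y \<otimes>\<^bsub>S\<^esub> e"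
    using cen[OF y] y up(2) by (simp add: S.minus_eq S.l_distr S.r_distr S.l_minus S.r_minus)
qed

lemma (in ring) self_neg_imp_zero:
  assumes two: "\<one> \<oplus> \<one> \<in> Units R" and x: "x \<in> carrier R" "x = \<ominus> x"
  shows "x = \<zero>"
proof -
  have "(\<one> \<oplus> \<one>) \<otimes> x = x \<oplus> x" using x(1) by (simp add: l_distr)
  also have "\<dots> = (\<one> \<oplus> \<one>) \<otimes> \<zero>" using x by (metis r_neg r_null two Units_closed)
  finally show ?thesis using Units_l_cancel[OF two x(1) zero_closed] by simp
qed

text \<open>The element \<open>(1 + q) / 2\<close> is idempotent.\<close>
lemma (in ring) square_one_central:
  assumes two: "\<one> \<oplus> \<one> \<in> Units R" and ic: "idempotents_central R"
    and q: "q \<in> carrier R" "q \<otimes> q = \<one>" and y: "y \<in> carrier R"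
  shows "q \<otimes> y = y \<otimes> q"
proof -
  obtain t where t: "t \<in> carrier R" "(\<one> \<oplus> \<one>) \<otimes> t = \<one>" "t \<otimes> (\<one> \<oplus> \<one>) = \<one>"
    using two by (auto simp: Units_def)
  have tc: "t \<otimes> x = x \<otimes> t" if x: "x \<in> carrier R" for x
  proof -
    have "t \<otimes> x = t \<otimes> (x \<otimes> (\<one> \<oplus> \<one>)) \<otimes> t" using x t by (simp add: m_assoc)
    also have "\<dots> = (t \<otimes> (\<one> \<oplus> \<one>)) \<otimes> x \<otimes> t" using x t(1) by algebra
    finally show ?thesis using x t by simp
  qed
  define e where "e = t \<otimes> (\<one> \<oplus> q)"
  have e: "e \<in> carrier R" using t q by (simp add: e_def)
  have "e \<otimes> e = t \<otimes> ((\<one> \<oplus> q) \<otimes> t) \<otimes> (\<one> \<oplus> q)" using t q by (simp add: e_def m_assoc)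
  also have "\<dots> = t \<otimes> t \<otimes> ((\<one> \<oplus> q) \<otimes> (\<one> \<oplus> q))"
    using t(1) q(1) tc[of "\<one> \<oplus> q"] by (metis a_closed m_assoc m_closed one_closed)
  also have "(\<one> \<oplus> q) \<otimes> (\<one> \<oplus> q) = \<one> \<oplus> (q \<oplus> q) \<oplus> q \<otimes> q" using q(1) by (simp add: l_distr r_distr a_ac)
  also have "\<dots> = (\<one> \<oplus> \<one>) \<otimes> (\<one> \<oplus> q)" unfolding q(2) using q(1) by (simp add: l_distr r_distr a_ac)
  also have "t \<otimes> t \<otimes> ((\<one> \<oplus> \<one>) \<otimes> (\<one> \<oplus> q)) = t \<otimes> (t \<otimes> (\<one> \<oplus> \<one>)) \<otimes> (\<one> \<oplus> q)"
    using t(1) q(1) by algebra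
  finally have "e \<otimes> e = e" using t q by (simp add: e_def)
  then have ey: "e \<otimes> y = y \<otimes> e" using ic e y by (auto simp: idempotents_central_def)
  have q': "q = (\<one> \<oplus> \<one>) \<otimes> e \<ominus> \<one>"
  proof -
    have "(\<one> \<oplus> \<one>) \<otimes> e = ((\<one> \<oplus> \<one>) \<otimes> t) \<otimes> (\<one> \<oplus> q)" using t(1) q(1) by (simp add: e_def m_assoc)
    then show ?thesis using t q by simp algebra
  qed
  have "q \<otimes> y = e \<otimes> y \<oplus> e \<otimes> y \<ominus> y" unfolding q' using e y by (algebra; simp add: a_ac)
  also have "\<dots> = y \<otimes> q" unfolding ey unfolding q' using e y by (algebra; simp add: a_ac)
  finally show ?thesis .
qed

lemma (in ring) square_one_anticommute:
  assumes two: "\<one> \<oplus> \<one> \<in> Units R" and ic: "idempotents_central R"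
    and q: "q \<in> carrier R" "q \<otimes> q = \<one>" and y: "y \<in> carrier R" and anti: "q \<otimes> y = \<ominus> (y \<otimes> q)"
  shows "y = \<zero>"
proof -
  have "q \<otimes> y = \<zero>"
    using self_neg_imp_zero[OF two, of "q \<otimes> y"] anti square_one_central[OF two ic q y] q y by simp
  then have "q \<otimes> q \<otimes> y = \<zero>" using q(1) y by (simp add: m_assoc)
  then show ?thesis using q y by simp
qed

lemma (in ring) anticommute_square_add:
  assumes "u \<in> carrier R" "v \<in> carrier R" "u \<otimes> v = \<ominus> (v \<otimes> u)"
  shows "(u \<oplus> v) \<otimes> (u \<oplus> v) = u \<otimes> u \<oplus> v \<otimes> v"
proof -
  have "(u \<oplus> v) \<otimes> (u \<oplus> v) = u \<otimes> u \<oplus> v \<otimes> v \<oplus> (v \<otimes> u \<oplus> u \<otimes> v)" using assms(1,2) by algebra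
  then show ?thesis using assms by (simp add: r_neg)
qed

text \<open>The element \<open>q = x a + y b + z a b\<close> is a pure quaternion with
  \<open>q\<^sup>2 = - (x\<^sup>2 + y\<^sup>2 + z\<^sup>2) = 1\<close>, hence central. Its part \<open>r = y b + z a b\<close> anticommutes with \<open>a\<close>
  while \<open>q\<close> and \<open>x a\<close> commute with \<open>a\<close>, so \<open>r = 0\<close>. But then \<open>q = x a\<close> anticommutes with the
  unit \<open>b\<close>.\<close>
lemma (in ring) quaternions_three_squares_trivial:
  assumes two: "\<one> \<oplus> \<one> \<in> Units R" and ic: "idempotents_central R"
    and ab: "a \<in> carrier R" "b \<in> carrier R"
    and rel: "a \<otimes> a = \<ominus> \<one>" "b \<otimes> b = \<ominus> \<one>" "b \<otimes> a = \<ominus> (a \<otimes> b)"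
    and x: "x \<in> carrier R" "\<And>c. c \<in> carrier R \<Longrightarrow> c \<otimes> x = x \<otimes> c"
    and y: "y \<in> carrier R" "\<And>c. c \<in> carrier R \<Longrightarrow> c \<otimes> y = y \<otimes> c"
    and z: "z \<in> carrier R" "\<And>c. c \<in> carrier R \<Longrightarrow> c \<otimes> z = z \<otimes> c"
    and sum: "x \<otimes> x \<oplus> y \<otimes> y \<oplus> z \<otimes> z \<oplus> \<one> = \<zero>"
  shows "\<one> = \<zero>"
proof -
  note car = ab x(1) y(1) z(1)
  have pull: "(x \<otimes> c) \<otimes> (y \<otimes> d) = (x \<otimes> y) \<otimes> (c \<otimes> d)"
    if "x \<in> carrier R" "c \<in> carrier R" "y \<in> carrier R" "d \<in> carrier R" "c \<otimes> y = y \<otimes> c" for x c y d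
    using that by (metis m_assoc m_closed)
  define k where "k = a \<otimes> b"
  have k: "k \<in> carrier R" using ab by (simp add: k_def)
  have ak: "a \<otimes> k = \<ominus> b" using ab rel by (simp add: k_def l_minus flip: m_assoc)
  have ka: "k \<otimes> a = b"
    using ab rel by (simp add: k_def m_assoc r_minus) (simp add: l_minus flip: m_assoc)
  have bk: "b \<otimes> k = a"
    using ab rel by (simp add: k_def l_minus flip: m_assoc) (simp add: r_minus m_assoc)
  have kb: "k \<otimes> b = \<ominus> a" using ab rel by (simp add: k_def m_assoc r_minus)
  have kk: "k \<otimes> k = \<ominus> \<one>"
    using ab k rel bk by (subst k_def, simp add: m_assoc)
  define r where "r = y \<otimes> b \<oplus> z \<otimes> k"
  define q where "q = x \<otimes> a \<oplus> r"
  have r: "r \<in> carrier R" and q: "q \<in> carrier R" using car k by (auto simp: r_def q_def)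
  have "(y \<otimes> b) \<otimes> (z \<otimes> k) = \<ominus> ((z \<otimes> k) \<otimes> (y \<otimes> b))"
    using pull[of y b z k] pull[of z k y b] car k bk kb y(2)[OF k] y(2)[OF z(1)] z(2)[OF ab(2)]
    by (simp add: r_minus)
  then have "r \<otimes> r = (y \<otimes> b) \<otimes> (y \<otimes> b) \<oplus> (z \<otimes> k) \<otimes> (z \<otimes> k)"
    unfolding r_def using car k by (intro anticommute_square_add) auto
  also have "\<dots> = \<ominus> (y \<otimes> y) \<ominus> z \<otimes> z"
    using pull[of y b y b] pull[of z k z k] car k rel kk y(2)[OF ab(2)] z(2)[OF k]
    by (simp add: r_minus minus_eq)
  finally have rr: "r \<otimes> r = \<ominus> (y \<otimes> y) \<ominus> z \<otimes> z" .
  have ra: "r \<otimes> a = \<ominus> (a \<otimes> r)"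
  proof -
    have "a \<otimes> r = y \<otimes> (a \<otimes> b) \<oplus> z \<otimes> (a \<otimes> k)"
      unfolding r_def
      using m_assoc[of a y b] m_assoc[of y a b] m_assoc[of a z k] m_assoc[of z a k]
        car k y(2)[of a] z(2)[of a] by (simp add: r_distr)
    moreover have "r \<otimes> a = y \<otimes> (b \<otimes> a) \<oplus> z \<otimes> (k \<otimes> a)"
      unfolding r_def using car k by (simp add: l_distr m_assoc)
    ultimately show ?thesis using car k ak ka rel(3) by (simp add: r_minus minus_add)
  qed
  have xaa: "(x \<otimes> a) \<otimes> a = a \<otimes> (x \<otimes> a)" using car x(2)[of a] by (metis m_assoc)
  have rxa: "(x \<otimes> a) \<otimes> r = \<ominus> (r \<otimes> (x \<otimes> a))"
  proof -
    have "r \<otimes> (x \<otimes> a) = x \<otimes> (r \<otimes> a)" using car r x(2)[OF r] by (metis m_assoc)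
    then show ?thesis using car r ra by (simp add: r_minus m_assoc)
  qed
  have "q \<otimes> q = (x \<otimes> a) \<otimes> (x \<otimes> a) \<oplus> r \<otimes> r"
    unfolding q_def using car r rxa by (intro anticommute_square_add) auto
  also have "\<dots> = \<one> \<ominus> (x \<otimes> x \<oplus> y \<otimes> y \<oplus> z \<otimes> z \<oplus> \<one>)"
  proof -
    have "(x \<otimes> a) \<otimes> (x \<otimes> a) = \<ominus> (x \<otimes> x)"
      using pull[of x a x a] car rel(1) x(2)[OF ab(1)] by (simp add: r_minus)
    then show ?thesis unfolding rr using car by (simp, algebra)
  qed
  also have "\<dots> = \<one>" unfolding sum by algebra
  finally have qq: "q \<otimes> q = \<one>" .
  note comm = square_one_central[OF two ic q qq]
  have "r = q \<ominus> x \<otimes> a" unfolding q_def using car r by algebra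
  then have "r \<otimes> a = a \<otimes> r"
    using comm[OF ab(1)] xaa car q by (simp add: minus_eq l_distr r_distr l_minus r_minus)
  then have "r \<otimes> a = \<ominus> (r \<otimes> a)" using ra by simp
  then have "r \<otimes> a = \<zero>" using self_neg_imp_zero[OF two] car r by simp
  then have "r \<otimes> a \<otimes> a = \<zero>" using car by simp
  then have "r = \<zero>" using car r rel(1) by (simp add: m_assoc r_minus)
  then have "q = x \<otimes> a" using car by (simp add: q_def)
  moreover have "(x \<otimes> a) \<otimes> b = \<ominus> (b \<otimes> (x \<otimes> a))"
  proof -
    have "b \<otimes> (x \<otimes> a) = x \<otimes> (b \<otimes> a)" using car x(2)[OF ab(2)] by (metis m_assoc)
    then show ?thesis using car rel(3) by (simp add: r_minus m_assoc)
  qed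
  ultimately have "b = \<zero>" using square_one_anticommute[OF two ic q qq ab(2)] by simp
  then have "\<ominus> \<one> = \<zero>" using rel(2) by simp
  then show ?thesis by (metis minus_minus minus_zero one_closed)
qed

section \<open>Minus one as a sum of two squares\<close>

text \<open>The product of \<open>1 + (z\<^sup>2)\<^sup>m\<close> over \<open>m = 1, 2, 4, ...\<close> telescopes against \<open>1 - z\<^sup>2\<close>. Each
  factor is the sum of the squares of \<open>1\<close> and \<open>z\<^sup>m\<close>, and the two-squares identity combines the
  factors into a single sum \<open>u\<^sup>2 + v\<^sup>2\<close>.\<close>
lemma (in cring) telescoping_two_squares:
  assumes z: "z \<in> carrier R"
  shows "\<exists>u\<in>carrier R. \<exists>v\<in>carrier R.
    (\<one> \<ominus> z \<otimes> z) \<otimes> (u \<otimes> u \<oplus> v \<otimes> v) = \<one> \<ominus> z [^] (2 ^ Suc n :: nat)"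
proof (induction n)
  case 0
  show ?case
    by (rule bexI[of _ \<one>], rule bexI[of _ \<zero>]) (use z in \<open>simp_all add: numeral_2_eq_2\<close>)
next
  case (Suc n)
  then obtain u v where uv: "u \<in> carrier R" "v \<in> carrier R"
      "(\<one> \<ominus> z \<otimes> z) \<otimes> (u \<otimes> u \<oplus> v \<otimes> v) = \<one> \<ominus> z [^] (2 ^ Suc n :: nat)" by auto
  define y where "y = z [^] (2 ^ n :: nat)"
  have y: "y \<in> carrier R" using z by (simp add: y_def)
  have yy: "z [^] (2 ^ Suc n :: nat) = y \<otimes> y"
    using z by (simp only: y_def nat_pow_mult power_Suc mult_2)
  have yyyy: "z [^] (2 ^ Suc (Suc n) :: nat) = (y \<otimes> y) \<otimes> (y \<otimes> y)"
    using z by (simp only: y_def nat_pow_mult power_Suc mult_2)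
  \<comment> \<open>The product of \<open>u + v i\<close> and \<open>1 + y i\<close> in complex notation.\<close>
  define u' v' where "u' = u \<ominus> v \<otimes> y" and "v' = u \<otimes> y \<oplus> v"
  have car: "u' \<in> carrier R" "v' \<in> carrier R" using uv y by (auto simp: u'_def v'_def)
  have "u' \<otimes> u' \<oplus> v' \<otimes> v' = (u \<otimes> u \<oplus> v \<otimes> v) \<otimes> (\<one> \<oplus> y \<otimes> y)"
    unfolding u'_def v'_def using uv(1,2) y by algebra
  then have "(\<one> \<ominus> z \<otimes> z) \<otimes> (u' \<otimes> u' \<oplus> v' \<otimes> v')
      = ((\<one> \<ominus> z \<otimes> z) \<otimes> (u \<otimes> u \<oplus> v \<otimes> v)) \<otimes> (\<one> \<oplus> y \<otimes> y)"
    using uv(1,2) y z by (simp add: m_assoc)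
  also have "\<dots> = \<one> \<ominus> (y \<otimes> y) \<otimes> (y \<otimes> y)" unfolding uv(3) yy using y by algebra
  finally show ?case unfolding yyyy using car by blast
qed

text \<open>Up to the factor \<open>1 - z\<^sup>2\<close>, the element \<open>-1\<close> is a sum of two squares: the right-hand
  side of the telescoped product is \<open>1 - z\<^bsup>-2\<^esup> = - z\<^bsup>-2\<^esup> (1 - z\<^sup>2)\<close>, and \<open>x = u z\<close>, \<open>y = v z\<close> absorb
  the unit. The equation is stated without subtraction so that it can be read
  in a subring and in the ambient ring alike.\<close>
lemma (in cring) minus_one_two_squares:
  assumes z: "z \<in> carrier R" "z [^] (2 ^ n + 1 :: nat) = \<one>"
  shows "\<exists>x\<in>carrier R. \<exists>y\<in>carrier R. 
    (z \<otimes> z) \<otimes> (x \<otimes> x \<oplus> y \<otimes> y \<oplus> \<one>) = x \<otimes> x \<oplus> y \<otimes> y \<oplus> \<one>"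
proof -
  obtain u v where uv: "u \<in> carrier R" "v \<in> carrier R"
      "(\<one> \<ominus> z \<otimes> z) \<otimes> (u \<otimes> u \<oplus> v \<otimes> v) = \<one> \<ominus> z [^] (2 ^ Suc n :: nat)"
    using telescoping_two_squares[OF z(1)] by blast
  have zp: "z [^] (2 ^ Suc n :: nat) \<otimes> (z \<otimes> z) = \<one>"
  proof -
    have "z [^] (2 ^ Suc n :: nat) \<otimes> (z \<otimes> z) = z [^] (2 ^ n + 1 :: nat) \<otimes> z [^] (2 ^ n + 1 :: nat)"
    proof -
      have *: "z [^] (2 ^ Suc n :: nat) = z [^] (2 ^ n :: nat) \<otimes> z [^] (2 ^ n :: nat)"
        using z(1) by (simp only: nat_pow_mult power_Suc mult_2)
      have "z [^] (2 ^ n + 1 :: nat) = z [^] (2 ^ n :: nat) \<otimes> z" using z(1) by simp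
      then show ?thesis unfolding * using nat_pow_closed[OF z(1), of "2 ^ n"] z(1) by algebra
    qed
    then show ?thesis using z(2) by simp
  qed
  have "(\<one> \<ominus> z \<otimes> z) \<otimes> ((u \<otimes> z) \<otimes> (u \<otimes> z) \<oplus> (v \<otimes> z) \<otimes> (v \<otimes> z) \<oplus> \<one>)
     = ((\<one> \<ominus> z \<otimes> z) \<otimes> (u \<otimes> u \<oplus> v \<otimes> v)) \<otimes> (z \<otimes> z) \<oplus> (\<one> \<ominus> z \<otimes> z)"
  proof -
    have "(u \<otimes> z) \<otimes> (u \<otimes> z) \<oplus> (v \<otimes> z) \<otimes> (v \<otimes> z) = (u \<otimes> u \<oplus> v \<otimes> v) \<otimes> (z \<otimes> z)"
      using uv(1,2) z(1) by algebra
    moreover have "c \<otimes> (d \<otimes> e \<oplus> \<one>) = (c \<otimes> d) \<otimes> e \<oplus> c"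
      if "c \<in> carrier R" "d \<in> carrier R" "e \<in> carrier R" for c d e
      using that by (simp add: r_distr m_assoc)
    ultimately show ?thesis using uv(1,2) z(1) by simp
  qed
  also have "\<dots> = z \<otimes> z \<ominus> z [^] (2 ^ Suc n :: nat) \<otimes> (z \<otimes> z) \<oplus> (\<one> \<ominus> z \<otimes> z)"
    unfolding uv(3) using nat_pow_closed[OF z(1), of "2 ^ Suc n"] z(1) by algebra
  also have "\<dots> = \<zero>" unfolding zp using z(1) by algebra
  finally have eq: "(\<one> \<ominus> z \<otimes> z) \<otimes> ((u \<otimes> z) \<otimes> (u \<otimes> z) \<oplus> (v \<otimes> z) \<otimes> (v \<otimes> z) \<oplus> \<one>) = \<zero>" .
  have cancel: "(z \<otimes> z) \<otimes> t = t" if "t \<in> carrier R" "(\<one> \<ominus> z \<otimes> z) \<otimes> t = \<zero>" for t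
  proof -
    have "(z \<otimes> z) \<otimes> t = t \<ominus> (\<one> \<ominus> z \<otimes> z) \<otimes> t" using that(1) z(1) by algebra
    then show ?thesis using that by (simp add: minus_eq)
  qed
  show ?thesis
    by (intro bexI[of _ "u \<otimes> z"] bexI[of _ "v \<otimes> z"] cancel eq) (use uv z in simp_all)
qed

definition ring_center :: "('a, 'm) ring_scheme \<Rightarrow> 'a set" where
  "ring_center R = {z \<in> carrier R. \<forall>y\<in>carrier R. y \<otimes>\<^bsub>R\<^esub> z = z \<otimes>\<^bsub>R\<^esub> y}"

lemma (in ring) subcring_center: "subcring (ring_center R) R"
proof (rule subcringI)
  show "subring (ring_center R) R"
  proof (rule subringI)
    fix z w assume "z \<in> ring_center R" "w \<in> ring_center R"
    then have z: "z \<in> carrier R" "\<And>y. y \<in> carrier R \<Longrightarrow> y \<otimes> z = z \<otimes> y"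
      and w: "w \<in> carrier R" "\<And>y. y \<in> carrier R \<Longrightarrow> y \<otimes> w = w \<otimes> y"
      by (auto simp: ring_center_def)
    have "y \<otimes> (z \<otimes> w) = z \<otimes> w \<otimes> y" if y: "y \<in> carrier R" for y
      using z(1) w(1) z(2)[OF y] w(2)[OF y] y by (metis m_assoc)
    then show "z \<otimes> w \<in> ring_center R" using z(1) w(1) by (simp add: ring_center_def)
    show "z \<oplus> w \<in> ring_center R" using z w by (simp add: ring_center_def l_distr r_distr)
    show "\<ominus> z \<in> ring_center R" using z by (simp add: ring_center_def l_minus r_minus)
  qed (auto simp: ring_center_def)
next
  fix z w assume "z \<in> ring_center R" "w \<in> ring_center R"
  then show "z \<otimes> w = w \<otimes> z" unfolding ring_center_def by blast
qed

section \<open>The group ring and its action on functions\<close>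

locale group_algebra = group G + R: cring R for G (structure) and R (structure)
begin

abbreviation RG where "RG \<equiv> group_ring R G"
text \<open>All functions from the group to the coefficients, without a condition on the support. The
  product formula of \<open>group_ring\<close> still makes sense when only its left factor has finite support, and
  it makes this set a module over the group ring. Keeping the right factor general in the laws below is what
  later allows annihilators of functions with infinite support.\<close>
definition funs where "funs = carrier G \<rightarrow>\<^sub>E carrier R"

definition monom where "monom r g = (\<lambda>x\<in>carrier G. if x = g then r else \<zero>\<^bsub>R\<^esub>)"

lemma carrier_iff: "f \<in> carrier RG \<longleftrightarrow> f \<in> funs \<and> finite (grsupp R G f)"
  by (simp add: group_ring_def funs_def)

lemma funs_closed: "f \<in> funs \<Longrightarrow> x \<in> carrier G \<Longrightarrow> f x \<in> carrier R"
  by (auto simp: funs_def)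

lemma carrier_funs: "f \<in> carrier RG \<Longrightarrow> f \<in> funs"
  by (simp add: carrier_iff)

lemma carrier_apply: "f \<in> carrier RG \<Longrightarrow> x \<in> carrier G \<Longrightarrow> f x \<in> carrier R"
  using carrier_funs funs_closed by blast

lemma funs_eqI:
  assumes "f \<in> funs" "h \<in> funs" "\<And>x. x \<in> carrier G \<Longrightarrow> f x = h x" shows "f = h"
  using assms unfolding funs_def by (rule PiE_ext)

lemma grsupp_subset: "grsupp R G f \<subseteq> carrier G"
  by (auto simp: grsupp_def)

lemma add_apply: "x \<in> carrier G \<Longrightarrow> (f \<oplus>\<^bsub>RG\<^esub> h) x = f x \<oplus>\<^bsub>R\<^esub> h x"
  by (simp add: group_ring_def)

lemma zero_apply: "x \<in> carrier G \<Longrightarrow> \<zero>\<^bsub>RG\<^esub> x = \<zero>\<^bsub>R\<^esub>"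
  by (simp add: group_ring_def)

lemma mult_apply:
  "x \<in> carrier G \<Longrightarrow> (f \<otimes>\<^bsub>RG\<^esub> h) x = (\<Oplus>\<^bsub>R\<^esub>y\<in>grsupp R G f. f y \<otimes>\<^bsub>R\<^esub> h (inv y \<otimes> x))"
  by (simp add: group_ring_def)

lemma monom_apply: "x \<in> carrier G \<Longrightarrow> monom r g x = (if x = g then r else \<zero>\<^bsub>R\<^esub>)"
  by (simp add: monom_def)

lemma one_eq_monom: "\<one>\<^bsub>RG\<^esub> = monom \<one>\<^bsub>R\<^esub> \<one>"
  by (simp add: group_ring_def monom_def)

lemma monom_closed: "r \<in> carrier R \<Longrightarrow> monom r g \<in> carrier RG"
  by (auto simp: carrier_iff funs_def monom_def grsupp_def intro: finite_subset[of _ "{g}"])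

lemma monom_add:
  assumes "r \<in> carrier R" "t \<in> carrier R"
  shows "monom r g \<oplus>\<^bsub>RG\<^esub> monom t g = monom (r \<oplus>\<^bsub>R\<^esub> t) g"
  using assms by (auto simp: group_ring_def monom_def fun_eq_iff)

lemma zero_closed: "\<zero>\<^bsub>RG\<^esub> \<in> carrier RG"
  by (auto simp: group_ring_def grsupp_def)

lemma add_funs: "f \<in> funs \<Longrightarrow> h \<in> funs \<Longrightarrow> f \<oplus>\<^bsub>RG\<^esub> h \<in> funs"
  by (auto simp: group_ring_def funs_def)

lemma add_closed:
  assumes "f \<in> carrier RG" "h \<in> carrier RG" shows "f \<oplus>\<^bsub>RG\<^esub> h \<in> carrier RG"
proof -
  have "grsupp R G (f \<oplus>\<^bsub>RG\<^esub> h) \<subseteq> grsupp R G f \<union> grsupp R G h"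
    by (auto simp: grsupp_def add_apply)
  then show ?thesis using assms add_funs unfolding carrier_iff by (meson finite_UnI finite_subset)
qed

lemma mult_apply_superset:
  assumes "f \<in> funs" "h \<in> funs" "finite F" "grsupp R G f \<subseteq> F" "F \<subseteq> carrier G" "x \<in> carrier G"
  shows "(f \<otimes>\<^bsub>RG\<^esub> h) x = (\<Oplus>\<^bsub>R\<^esub>y\<in>F. f y \<otimes>\<^bsub>R\<^esub> h (inv y \<otimes> x))"
  unfolding mult_apply[OF assms(6)]
proof (rule R.add.finprod_mono_neutral_cong_left)
  fix y assume "y \<in> F - grsupp R G f"
  then have "y \<in> carrier G" "f y = \<zero>\<^bsub>R\<^esub>" using assms(5) by (auto simp: grsupp_def)
  then show "f y \<otimes>\<^bsub>R\<^esub> h (inv y \<otimes> x) = \<zero>\<^bsub>R\<^esub>" using funs_closed[OF assms(2)] assms(6) by simp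
qed (use assms funs_closed in auto)

lemma mult_funs:
  assumes "f \<in> funs" "h \<in> funs" shows "f \<otimes>\<^bsub>RG\<^esub> h \<in> funs"
proof -
  have "(\<Oplus>\<^bsub>R\<^esub>y\<in>grsupp R G f. f y \<otimes>\<^bsub>R\<^esub> h (inv y \<otimes> x)) \<in> carrier R" if "x \<in> carrier G" for x
    using that grsupp_subset[of f] funs_closed[OF assms(1)] funs_closed[OF assms(2)]
    by (intro R.finsum_closed) auto
  then show ?thesis by (auto simp: group_ring_def funs_def)
qed

lemma monom_mult_apply:
  assumes "r \<in> carrier R" "g \<in> carrier G" "h \<in> funs" "x \<in> carrier G"
  shows "(monom r g \<otimes>\<^bsub>RG\<^esub> h) x = r \<otimes>\<^bsub>R\<^esub> h (inv g \<otimes> x)"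
proof -
  have "grsupp R G (monom r g) \<subseteq> {g}" by (auto simp: grsupp_def monom_apply split: if_splits)
  then show ?thesis
    using mult_apply_superset[of "monom r g" h "{g}" x] assms carrier_funs[OF monom_closed]
      funs_closed[OF assms(3)]
    by (simp add: monom_apply)
qed

lemma mult_monom_apply:
  assumes "f \<in> carrier RG" "r \<in> carrier R" "g \<in> carrier G" "x \<in> carrier G"
  shows "(f \<otimes>\<^bsub>RG\<^esub> monom r g) x = f (x \<otimes> inv g) \<otimes>\<^bsub>R\<^esub> r"
proof -
  define F where "F = insert (x \<otimes> inv g) (grsupp R G f)"
  have F: "finite F" "F \<subseteq> carrier G" "grsupp R G f \<subseteq> F"
    using assms grsupp_subset by (auto simp: F_def carrier_iff)
  have eq: "inv y \<otimes> x = g \<longleftrightarrow> x \<otimes> inv g = y" if "y \<in> carrier G" for y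
    using that assms by (metis inv_closed inv_solve_left inv_solve_right m_closed)
  have "(f \<otimes>\<^bsub>RG\<^esub> monom r g) x = (\<Oplus>\<^bsub>R\<^esub>y\<in>F. f y \<otimes>\<^bsub>R\<^esub> monom r g (inv y \<otimes> x))"
    using F assms by (intro mult_apply_superset carrier_funs monom_closed)
  also have "\<dots> = (\<Oplus>\<^bsub>R\<^esub>y\<in>F. if x \<otimes> inv g = y then f y \<otimes>\<^bsub>R\<^esub> r else \<zero>\<^bsub>R\<^esub>)"
    using F assms eq carrier_apply[OF assms(1)]
    by (intro R.finsum_cong') (auto simp: monom_apply)
  also have "\<dots> = f (x \<otimes> inv g) \<otimes>\<^bsub>R\<^esub> r"
    using F assms carrier_apply[OF assms(1)] by (intro R.finsum_singleton) (auto simp: F_def)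
  finally show ?thesis .
qed

lemma mult_add_left:
  assumes "f \<in> carrier RG" "f' \<in> carrier RG" "h \<in> funs"
  shows "(f \<oplus>\<^bsub>RG\<^esub> f') \<otimes>\<^bsub>RG\<^esub> h = f \<otimes>\<^bsub>RG\<^esub> h \<oplus>\<^bsub>RG\<^esub> f' \<otimes>\<^bsub>RG\<^esub> h"
proof (rule funs_eqI)
  fix x assume x: "x \<in> carrier G"
  define F where "F = grsupp R G f \<union> grsupp R G f'"
  have F: "finite F" "F \<subseteq> carrier G" "grsupp R G f \<subseteq> F" "grsupp R G f' \<subseteq> F"
      "grsupp R G (f \<oplus>\<^bsub>RG\<^esub> f') \<subseteq> F"
    using assms by (auto simp: F_def carrier_iff grsupp_def add_apply)
  note car = carrier_funs[OF assms(1)] carrier_funs[OF assms(2)]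
  have c: "f y \<in> carrier R" "f' y \<in> carrier R" "h (inv y \<otimes> x) \<in> carrier R" if "y \<in> F" for y
    using that F(2) x assms carrier_apply funs_closed[OF assms(3)] by auto
  have "((f \<oplus>\<^bsub>RG\<^esub> f') \<otimes>\<^bsub>RG\<^esub> h) x = (\<Oplus>\<^bsub>R\<^esub>y\<in>F. (f \<oplus>\<^bsub>RG\<^esub> f') y \<otimes>\<^bsub>R\<^esub> h (inv y \<otimes> x))"
    using F x assms(3) car add_funs by (intro mult_apply_superset) auto
  also have "\<dots> = (\<Oplus>\<^bsub>R\<^esub>y\<in>F. f y \<otimes>\<^bsub>R\<^esub> h (inv y \<otimes> x) \<oplus>\<^bsub>R\<^esub> f' y \<otimes>\<^bsub>R\<^esub> h (inv y \<otimes> x))"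
    using F(2) c by (intro R.finsum_cong') (auto simp: add_apply R.l_distr subset_iff)
  also have "\<dots> = (\<Oplus>\<^bsub>R\<^esub>y\<in>F. f y \<otimes>\<^bsub>R\<^esub> h (inv y \<otimes> x)) \<oplus>\<^bsub>R\<^esub> (\<Oplus>\<^bsub>R\<^esub>y\<in>F. f' y \<otimes>\<^bsub>R\<^esub> h (inv y \<otimes> x))"
    using c by (intro R.finsum_addf) auto
  also have "\<dots> = (f \<otimes>\<^bsub>RG\<^esub> h \<oplus>\<^bsub>RG\<^esub> f' \<otimes>\<^bsub>RG\<^esub> h) x"
    using mult_apply_superset[OF car(1) assms(3) F(1,3,2) x]
      mult_apply_superset[OF car(2) assms(3) F(1,4,2) x] x by (simp add: add_apply)
  finally show "((f \<oplus>\<^bsub>RG\<^esub> f') \<otimes>\<^bsub>RG\<^esub> h) x = (f \<otimes>\<^bsub>RG\<^esub> h \<oplus>\<^bsub>RG\<^esub> f' \<otimes>\<^bsub>RG\<^esub> h) x" .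
qed (use assms carrier_funs add_funs mult_funs add_closed in auto)

lemma mult_add_right:
  assumes "f \<in> carrier RG" "h \<in> funs" "h' \<in> funs"
  shows "f \<otimes>\<^bsub>RG\<^esub> (h \<oplus>\<^bsub>RG\<^esub> h') = f \<otimes>\<^bsub>RG\<^esub> h \<oplus>\<^bsub>RG\<^esub> f \<otimes>\<^bsub>RG\<^esub> h'"
proof (rule funs_eqI)
  fix x assume x: "x \<in> carrier G"
  have c: "f y \<in> carrier R" "h (inv y \<otimes> x) \<in> carrier R" "h' (inv y \<otimes> x) \<in> carrier R"
    "inv y \<otimes> x \<in> carrier G" if "y \<in> grsupp R G f" for y
    using that grsupp_subset[of f] x assms(1) carrier_apply funs_closed[OF assms(2)]
      funs_closed[OF assms(3)] by auto
  have "(f \<otimes>\<^bsub>RG\<^esub> (h \<oplus>\<^bsub>RG\<^esub> h')) x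
      = (\<Oplus>\<^bsub>R\<^esub>y\<in>grsupp R G f. f y \<otimes>\<^bsub>R\<^esub> h (inv y \<otimes> x) \<oplus>\<^bsub>R\<^esub> f y \<otimes>\<^bsub>R\<^esub> h' (inv y \<otimes> x))"
    unfolding mult_apply[OF x] using c by (intro R.finsum_cong') (auto simp: add_apply R.r_distr)
  also have "\<dots> = (f \<otimes>\<^bsub>RG\<^esub> h \<oplus>\<^bsub>RG\<^esub> f \<otimes>\<^bsub>RG\<^esub> h') x"
    unfolding add_apply[OF x] mult_apply[OF x] using c by (intro R.finsum_addf) auto
  finally show "(f \<otimes>\<^bsub>RG\<^esub> (h \<oplus>\<^bsub>RG\<^esub> h')) x = (f \<otimes>\<^bsub>RG\<^esub> h \<oplus>\<^bsub>RG\<^esub> f \<otimes>\<^bsub>RG\<^esub> h') x" .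
qed (use assms carrier_funs add_funs mult_funs in auto)

text \<open>Identities that are additive in an argument need only be checked on monomials, where
  convolution is a translation and no sums occur.\<close>
lemma carrier_induct [consumes 1, case_names zero add]:
  assumes f: "f \<in> carrier RG" and zero: "P \<zero>\<^bsub>RG\<^esub>"
    and add: "\<And>f r g. f \<in> carrier RG \<Longrightarrow> r \<in> carrier R \<Longrightarrow> g \<in> carrier G \<Longrightarrow> P f \<Longrightarrow> P (monom r g \<oplus>\<^bsub>RG\<^esub> f)"
  shows "P f"
  using f
proof (induction "card (grsupp R G f)" arbitrary: f)
  case 0
  then have "grsupp R G f = {}" by (simp add: carrier_iff)
  then have "f = \<zero>\<^bsub>RG\<^esub>"
    using 0 carrier_funs zero_closed
    by (intro funs_eqI) (auto simp: grsupp_def zero_apply)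
  then show ?case using zero by simp
next
  case (Suc n)
  then obtain g where g: "g \<in> grsupp R G f" by (metis card.empty ex_in_conv nat.distinct(1))
  then have gc: "g \<in> carrier G" using grsupp_subset by blast
  define f' where "f' = (\<lambda>x\<in>carrier G. if x = g then \<zero>\<^bsub>R\<^esub> else f x)"
  have supp: "grsupp R G f' = grsupp R G f - {g}" by (auto simp: grsupp_def f'_def)
  have f': "f' \<in> carrier RG"
    using Suc(3) supp by (auto simp: carrier_iff funs_def f'_def)
  have "f = monom (f g) g \<oplus>\<^bsub>RG\<^esub> f'"
    using Suc(3) f' gc carrier_apply[OF Suc(3)] add_closed[OF monom_closed] carrier_funs
    by (intro funs_eqI) (auto simp: add_apply monom_apply f'_def)
  moreover have "n = card (grsupp R G f')"
    using Suc(2,3) g supp by (simp add: carrier_iff)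
  then have "P f'" using Suc(1) f' by blast
  ultimately show ?case using add[OF f' carrier_apply[OF Suc(3) gc] gc] by metis
qed

lemma zero_mult: "h \<in> funs \<Longrightarrow> \<zero>\<^bsub>RG\<^esub> \<otimes>\<^bsub>RG\<^esub> h = \<zero>\<^bsub>RG\<^esub>"
proof -
  have "grsupp R G \<zero>\<^bsub>RG\<^esub> = {}" by (auto simp: grsupp_def zero_apply)
  then show "\<zero>\<^bsub>RG\<^esub> \<otimes>\<^bsub>RG\<^esub> h = \<zero>\<^bsub>RG\<^esub>" if "h \<in> funs"
    using that zero_closed carrier_funs mult_funs
    by (intro funs_eqI) (auto simp: mult_apply zero_apply)
qed

lemma mult_zero: "f \<in> carrier RG \<Longrightarrow> f \<otimes>\<^bsub>RG\<^esub> \<zero>\<^bsub>RG\<^esub> = \<zero>\<^bsub>RG\<^esub>"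
  using zero_closed carrier_funs mult_funs grsupp_subset[of f] carrier_apply[of f]
  by (intro funs_eqI)
    (auto simp: mult_apply zero_apply subset_iff intro!: R.add.finprod_one_eqI)

lemma abelian_group_RG: "abelian_group RG"
proof (rule abelian_groupI)
  fix f assume f: "f \<in> carrier RG"
  define f' where "f' = (\<lambda>x\<in>carrier G. \<ominus>\<^bsub>R\<^esub> f x)"
  have "grsupp R G f' \<subseteq> grsupp R G f" using carrier_apply[OF f] by (auto simp: grsupp_def f'_def)
  then have f': "f' \<in> carrier RG"
    using f carrier_apply[OF f] by (auto simp: carrier_iff funs_def f'_def intro: finite_subset)
  moreover have "f' \<oplus>\<^bsub>RG\<^esub> f = \<zero>\<^bsub>RG\<^esub>"
    using add_closed[OF f' f] zero_closed carrier_funs carrier_apply[OF f]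
    by (intro funs_eqI) (auto simp: add_apply zero_apply f'_def R.l_neg)
  ultimately show "\<exists>h\<in>carrier RG. h \<oplus>\<^bsub>RG\<^esub> f = \<zero>\<^bsub>RG\<^esub>" by blast
next
  fix f h k assume "f \<in> carrier RG" "h \<in> carrier RG" "k \<in> carrier RG"
  then show "f \<oplus>\<^bsub>RG\<^esub> h \<oplus>\<^bsub>RG\<^esub> k = f \<oplus>\<^bsub>RG\<^esub> (h \<oplus>\<^bsub>RG\<^esub> k)"
    using add_closed carrier_funs carrier_apply
    by (intro funs_eqI) (auto simp: add_apply R.a_assoc)
next
  fix f h assume "f \<in> carrier RG" "h \<in> carrier RG"
  then show "f \<oplus>\<^bsub>RG\<^esub> h = h \<oplus>\<^bsub>RG\<^esub> f"
    using add_closed carrier_funs carrier_apply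
    by (intro funs_eqI) (auto simp: add_apply R.a_comm)
next
  fix f assume "f \<in> carrier RG"
  then show "\<zero>\<^bsub>RG\<^esub> \<oplus>\<^bsub>RG\<^esub> f = f"
    using add_closed zero_closed carrier_funs carrier_apply
    by (intro funs_eqI) (auto simp: add_apply zero_apply)
qed (auto simp: add_closed zero_closed)

lemma monom_mult_monom:
  assumes "r \<in> carrier R" "g \<in> carrier G" "t \<in> carrier R" "h \<in> carrier G"
  shows "monom r g \<otimes>\<^bsub>RG\<^esub> monom t h = monom (r \<otimes>\<^bsub>R\<^esub> t) (g \<otimes> h)"
proof (rule funs_eqI)
  fix x assume x: "x \<in> carrier G"
  have "inv g \<otimes> x = h \<longleftrightarrow> x = g \<otimes> h" using x assms by (metis inv_solve_left)
  then show "(monom r g \<otimes>\<^bsub>RG\<^esub> monom t h) x = monom (r \<otimes>\<^bsub>R\<^esub> t) (g \<otimes> h) x"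
    using x assms monom_mult_apply[OF assms(1,2) carrier_funs[OF monom_closed[OF assms(3)]] x]
    by (simp add: monom_apply)
qed (use assms carrier_funs monom_closed mult_funs in auto)

lemma mult_closed:
  assumes f: "f \<in> carrier RG" and h: "h \<in> carrier RG" shows "f \<otimes>\<^bsub>RG\<^esub> h \<in> carrier RG"
  using f
proof (induction rule: carrier_induct)
  case zero
  then show ?case using zero_mult[OF carrier_funs[OF h]] zero_closed by simp
next
  case (add f r g)
  have "monom r g \<otimes>\<^bsub>RG\<^esub> h \<in> carrier RG" using h
  proof (induction rule: carrier_induct)
    case zero
    then show ?case using mult_zero[OF monom_closed] add(2) zero_closed by simp
  next
    case (add h' t g')
    then show ?case
      using \<open>r \<in> carrier R\<close> \<open>g \<in> carrier G\<close>
      by (simp add: mult_add_right carrier_funs monom_closed monom_mult_monom add_closed)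
  qed
  then show ?case
    using add h by (simp add: mult_add_left monom_closed carrier_funs add_closed)
qed

lemma mult_assoc:
  assumes f: "f \<in> carrier RG" and h: "h \<in> carrier RG" and k: "k \<in> funs"
  shows "f \<otimes>\<^bsub>RG\<^esub> h \<otimes>\<^bsub>RG\<^esub> k = f \<otimes>\<^bsub>RG\<^esub> (h \<otimes>\<^bsub>RG\<^esub> k)"
  using f
proof (induction rule: carrier_induct)
  case zero
  then show ?case using h k by (simp add: zero_mult carrier_funs mult_funs)
next
  case (add f r g)
  note rg = add(2,3)
  have "monom r g \<otimes>\<^bsub>RG\<^esub> h \<otimes>\<^bsub>RG\<^esub> k = monom r g \<otimes>\<^bsub>RG\<^esub> (h \<otimes>\<^bsub>RG\<^esub> k)" using h
  proof (induction rule: carrier_induct)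
    case zero
    then show ?case using rg k by (simp add: zero_mult mult_zero monom_closed)
  next
    case (add h t g')
    have "monom r g \<otimes>\<^bsub>RG\<^esub> monom t g' \<otimes>\<^bsub>RG\<^esub> k = monom r g \<otimes>\<^bsub>RG\<^esub> (monom t g' \<otimes>\<^bsub>RG\<^esub> k)"
    proof (rule funs_eqI)
      fix x assume x: "x \<in> carrier G"
      have "inv (g \<otimes> g') \<otimes> x = inv g' \<otimes> (inv g \<otimes> x)"
        using x rg add(3) by (simp add: inv_mult_group m_assoc)
      then show "(monom r g \<otimes>\<^bsub>RG\<^esub> monom t g' \<otimes>\<^bsub>RG\<^esub> k) x = (monom r g \<otimes>\<^bsub>RG\<^esub> (monom t g' \<otimes>\<^bsub>RG\<^esub> k)) x"
        using x rg add(2,3) k funs_closed[OF k]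
        by (simp add: monom_mult_monom monom_mult_apply mult_funs carrier_funs monom_closed R.m_assoc)
    qed (use rg add k in \<open>simp_all add: mult_funs carrier_funs monom_closed mult_closed\<close>)
    then show ?case
      using rg add k by (simp add: mult_add_right mult_add_left carrier_funs monom_closed
          mult_closed mult_funs)
  qed
  then show ?case
    using add h k by (simp add: mult_add_left monom_closed carrier_funs mult_closed mult_funs)
qed

lemma one_mult: "k \<in> funs \<Longrightarrow> \<one>\<^bsub>RG\<^esub> \<otimes>\<^bsub>RG\<^esub> k = k"
  unfolding one_eq_monom
  by (rule funs_eqI)
    (simp_all add: monom_mult_apply funs_closed mult_funs carrier_funs monom_closed)

lemma mult_one: "f \<in> carrier RG \<Longrightarrow> f \<otimes>\<^bsub>RG\<^esub> \<one>\<^bsub>RG\<^esub> = f"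
  unfolding one_eq_monom
  by (rule funs_eqI)
    (simp_all add: mult_monom_apply carrier_apply mult_funs carrier_funs monom_closed)

theorem ring_RG: "ring RG"
proof (rule ringI[OF abelian_group_RG])
  show "monoid RG"
    by (rule monoidI)
      (auto simp: mult_closed mult_assoc carrier_funs one_mult mult_one one_eq_monom[symmetric]
        intro: monom_closed[of "\<one>\<^bsub>R\<^esub>" \<one>, folded one_eq_monom])
qed (auto simp: mult_add_left mult_add_right carrier_funs)

text \<open>For a monomial \<open>f\<close> the two products are translates of \<open>p\<close> from the left and from the
  right, which agree for a class function.\<close>
lemma central_if_class_function:
  assumes p: "p \<in> carrier RG" "\<And>x y. x \<in> carrier G \<Longrightarrow> y \<in> carrier G \<Longrightarrow> p (x \<otimes> y) = p (y \<otimes> x)"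
    and f: "f \<in> carrier RG"
  shows "p \<otimes>\<^bsub>RG\<^esub> f = f \<otimes>\<^bsub>RG\<^esub> p"
  using f
proof (induction rule: carrier_induct)
  case zero
  then show ?case using p(1) by (simp add: zero_mult mult_zero carrier_funs)
next
  case (add f r g)
  have "p \<otimes>\<^bsub>RG\<^esub> monom r g = monom r g \<otimes>\<^bsub>RG\<^esub> p"
    using add(2,3) p carrier_apply[OF p(1)]
    by (intro funs_eqI)
      (simp_all add: mult_monom_apply monom_mult_apply R.m_comm mult_funs carrier_funs monom_closed)
  then show ?case
    using add p(1) by (simp add: mult_add_left mult_add_right carrier_funs monom_closed)
qed

text \<open>The annihilator of any function is a left ideal. For a class function, the left translate of
  \<open>w\<close> by a group element is also a right translate, and right translation commutes with the action, so the
  annihilator is stable under right multiplication too.\<close>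
lemma ideal_annihilator:
  assumes w: "w \<in> funs" "\<And>x y. x \<in> carrier G \<Longrightarrow> y \<in> carrier G \<Longrightarrow> w (x \<otimes> y) = w (y \<otimes> x)"
  shows "ideal {f \<in> carrier RG. f \<otimes>\<^bsub>RG\<^esub> w = \<zero>\<^bsub>RG\<^esub>} RG" (is "ideal ?I RG")
proof (rule idealI[OF ring_RG])
  interpret RG: ring RG by (rule ring_RG)
  show "subgroup ?I (add_monoid RG)"
  proof (rule RG.add.subgroupI)
    show "?I \<noteq> {}" using zero_closed zero_mult[OF w(1)] by auto
    show "f \<oplus>\<^bsub>RG\<^esub> h \<in> ?I" if "f \<in> ?I" "h \<in> ?I" for f h
      using that w(1) by (simp add: mult_add_left)
    show "\<ominus>\<^bsub>RG\<^esub> f \<in> ?I" if f: "f \<in> ?I" for f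
    proof -
      have "(\<ominus>\<^bsub>RG\<^esub> f \<oplus>\<^bsub>RG\<^esub> f) \<otimes>\<^bsub>RG\<^esub> w = (\<ominus>\<^bsub>RG\<^esub> f) \<otimes>\<^bsub>RG\<^esub> w"
      proof -
        have "(\<ominus>\<^bsub>RG\<^esub> f) \<otimes>\<^bsub>RG\<^esub> w \<oplus>\<^bsub>RG\<^esub> \<zero>\<^bsub>RG\<^esub> = (\<ominus>\<^bsub>RG\<^esub> f) \<otimes>\<^bsub>RG\<^esub> w"
          using f w(1) carrier_funs mult_funs funs_closed zero_closed
          by (intro funs_eqI) (auto simp: add_apply zero_apply intro!: add_funs)
        then show ?thesis using f w(1) by (simp add: mult_add_left)
      qed
      then show ?thesis using f zero_mult[OF w(1)] by (simp add: RG.l_neg)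
    qed
  qed auto
next
  fix f h assume f: "f \<in> ?I" and h: "h \<in> carrier RG"
  show "h \<otimes>\<^bsub>RG\<^esub> f \<in> ?I" using f h w(1) by (simp add: mult_closed mult_assoc mult_zero)
  have "f \<otimes>\<^bsub>RG\<^esub> (h \<otimes>\<^bsub>RG\<^esub> w) = \<zero>\<^bsub>RG\<^esub>" using h
  proof (induction rule: carrier_induct)
    case zero
    then show ?case using f w(1) by (simp add: zero_mult mult_zero)
  next
    case (add h r g)
    have "f \<otimes>\<^bsub>RG\<^esub> (monom r g \<otimes>\<^bsub>RG\<^esub> w) = \<zero>\<^bsub>RG\<^esub>"
    proof (rule funs_eqI)
      fix x assume x: "x \<in> carrier G"
      have c: "f y \<in> carrier R" "w (inv y \<otimes> (x \<otimes> inv g)) \<in> carrier R" "y \<in> carrier G"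
        if "y \<in> grsupp R G f" for y
        using that grsupp_subset[of f] x add(3) f carrier_apply funs_closed[OF w(1)] by auto
      have "f y \<otimes>\<^bsub>R\<^esub> (monom r g \<otimes>\<^bsub>RG\<^esub> w) (inv y \<otimes> x) = r \<otimes>\<^bsub>R\<^esub> (f y \<otimes>\<^bsub>R\<^esub> w (inv y \<otimes> (x \<otimes> inv g)))"
        if y: "y \<in> grsupp R G f" for y
      proof -
        have "w (inv g \<otimes> (inv y \<otimes> x)) = w (inv y \<otimes> (x \<otimes> inv g))"
          using w(2)[of "inv g" "inv y \<otimes> x"] x add(3) c[OF y] by (simp add: m_assoc)
        then show ?thesis
          using c[OF y] add(2,3) x w(1) by (simp add: monom_mult_apply R.m_lcomm)
      qed
      then have "(f \<otimes>\<^bsub>RG\<^esub> (monom r g \<otimes>\<^bsub>RG\<^esub> w)) x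
          = (\<Oplus>\<^bsub>R\<^esub>y\<in>grsupp R G f. r \<otimes>\<^bsub>R\<^esub> (f y \<otimes>\<^bsub>R\<^esub> w (inv y \<otimes> (x \<otimes> inv g))))"
        unfolding mult_apply[OF x] using c add(2) by (intro R.finsum_cong') auto
      also have "\<dots> = r \<otimes>\<^bsub>R\<^esub> (f \<otimes>\<^bsub>RG\<^esub> w) (x \<otimes> inv g)"
        using mult_apply[of "x \<otimes> inv g" f w] x add(2,3) f c
        by (simp add: carrier_iff R.finsum_rdistr Pi_def)
      also have "\<dots> = \<zero>\<^bsub>RG\<^esub> x" using f x add(2,3) by (simp add: zero_apply)
      finally show "(f \<otimes>\<^bsub>RG\<^esub> (monom r g \<otimes>\<^bsub>RG\<^esub> w)) x = \<zero>\<^bsub>RG\<^esub> x" .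
    qed (use f add w(1) zero_closed in \<open>simp_all add: mult_funs carrier_funs monom_closed\<close>)
    moreover have "\<zero>\<^bsub>RG\<^esub> \<oplus>\<^bsub>RG\<^esub> \<zero>\<^bsub>RG\<^esub> = \<zero>\<^bsub>RG\<^esub>" 
      using ring_RG zero_closed by (simp add: ring_def abelian_group_def abelian_monoid.l_zero)
    ultimately show ?case
      using add f w(1) by (simp add: mult_add_left mult_add_right monom_closed carrier_funs mult_funs)
  qed
  then show "f \<otimes>\<^bsub>RG\<^esub> h \<in> ?I" using f h w(1) by (simp add: mult_closed mult_assoc)
qed

end

section \<open>SLC-groups\<close>

lemma (in group) SLC_commute:
  assumes "SLC_group G" and x: "x \<in> carrier G" and y: "y \<in> carrier G"
  shows "x \<otimes> y = y \<otimes> x \<or> x \<otimes> y = SLC_s G \<otimes> (y \<otimes> x)"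
proof -
  have "x \<otimes> y \<otimes> inv x \<otimes> inv y \<in> derived_set G (carrier G)" using x y by blast
  then have "x \<otimes> y \<otimes> inv x \<otimes> inv y \<in> {\<one>, SLC_s G}"
    using SLC_s_props(2)[OF assms(1)] generate.incl[of _ "derived_set G (carrier G)" G]
    unfolding derived_def by simp
  moreover have "x \<otimes> y = (x \<otimes> y \<otimes> inv x \<otimes> inv y) \<otimes> (y \<otimes> x)"
  proof -
    have "inv y \<otimes> (y \<otimes> x) = x" using x y m_assoc[of "inv y" y x] by simp
    then show ?thesis using x y by (simp add: m_assoc)
  qed
  ultimately show ?thesis using x y by auto
qed

lemma (in group) noncommuting_product_not_center:
  assumes "x \<in> carrier G" "y \<in> carrier G" "x \<otimes> y \<noteq> y \<otimes> x" shows "x \<otimes> y \<notin> group_center G"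
proof
  assume "x \<otimes> y \<in> group_center G"
  then have "(x \<otimes> y) \<otimes> x = x \<otimes> (x \<otimes> y)" using assms(1) by (auto simp: group_center_def)
  then have "x \<otimes> (x \<otimes> y) = x \<otimes> (y \<otimes> x)" using assms(1,2) by (simp add: m_assoc)
  then show False using assms by simp
qed

locale SLC = group G for G (structure) +
  assumes SLC: "SLC_group G"
begin

abbreviation s where "s \<equiv> SLC_s G"
abbreviation Z where "Z \<equiv> group_center G"

lemma centerD: "z \<in> Z \<Longrightarrow> z \<in> carrier G" "z \<in> Z \<Longrightarrow> g \<in> carrier G \<Longrightarrow> z \<otimes> g = g \<otimes> z"
  by (auto simp: group_center_def)

lemma centerI: "z \<in> carrier G \<Longrightarrow> (\<And>g. g \<in> carrier G \<Longrightarrow> z \<otimes> g = g \<otimes> z) \<Longrightarrow> z \<in> Z"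
  by (simp add: group_center_def)

lemma subgroup_center: "subgroup Z G"
  using normal_group_center[OF is_group] by (simp add: normal_def)

lemma s_center: "s \<in> Z" and s_closed [simp]: "s \<in> carrier G" and s_square: "s \<otimes> s = \<one>"
  and s_not_one: "s \<noteq> \<one>"
  using SLC_s_props[OF SLC] centerD by auto

lemma s_comm: "g \<in> carrier G \<Longrightarrow> g \<otimes> s = s \<otimes> g"
  using centerD(2)[OF s_center] by simp

lemma s_cancel: "g \<in> carrier G \<Longrightarrow> s \<otimes> (s \<otimes> g) = g"
  using m_assoc[of s s g] by (simp add: s_square)

lemma s_mult_neq: "g \<in> carrier G \<Longrightarrow> s \<otimes> g \<noteq> g"
  using s_not_one r_cancel_one'[OF _ s_closed, of g] by auto

lemma commute: "x \<in> carrier G \<Longrightarrow> y \<in> carrier G \<Longrightarrow> x \<otimes> y = y \<otimes> x \<or> x \<otimes> y = s \<otimes> (y \<otimes> x)"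
  using SLC_commute[OF SLC] .

lemma anticommute_imp_not_center:
  assumes "x \<in> carrier G" "y \<in> carrier G" "x \<otimes> y = s \<otimes> (y \<otimes> x)"
  shows "x \<notin> Z" "y \<notin> Z"
  using assms s_mult_neq[of "y \<otimes> x"] centerD(2)[of x y] centerD(2)[of y x] by auto

lemma not_center_anticommute:
  assumes "x \<in> carrier G" "x \<notin> Z"
  obtains y where "y \<in> carrier G" "x \<otimes> y = s \<otimes> (y \<otimes> x)"
  using assms centerI[of x] commute[of x] by metis

lemma exists_not_center:
  obtains g where "g \<in> carrier G" "g \<notin> Z"
proof -
  have "carrier G \<noteq> Z"
  proof
    assume eq: "carrier G = Z"
    have "derived_set G (carrier G) \<subseteq> {\<one>}"
    proof safe
      fix x y assume xy: "x \<in> carrier G" "y \<in> carrier G"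
      have "x \<otimes> y = y \<otimes> x" using eq xy centerD(2) by blast
      then show "x \<otimes> y \<otimes> inv x \<otimes> inv y = \<one>" using xy by (simp add: m_assoc)
    qed
    then have "derived G (carrier G) \<subseteq> {\<one>}"
      unfolding derived_def using generate_subgroup_incl[OF _ triv_subgroup] by blast
    then show False using SLC_s_props(1,2)[OF SLC] by auto
  qed
  then show ?thesis using that centerD(1) by blast
qed

lemma square_center:
  assumes "x \<in> carrier G" shows "x \<otimes> x \<in> Z"
proof (rule centerI)
  fix y assume y: "y \<in> carrier G"
  show "x \<otimes> x \<otimes> y = y \<otimes> (x \<otimes> x)"
  proof (cases "x \<otimes> y = y \<otimes> x")
    case True
    then show ?thesis using assms y by (metis m_assoc)
  next
    case False
    then have *: "x \<otimes> y = s \<otimes> (y \<otimes> x)" using commute[OF assms y] by simp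
    have "x \<otimes> x \<otimes> y = x \<otimes> (s \<otimes> (y \<otimes> x))" using assms y * by (simp add: m_assoc)
    also have "\<dots> = s \<otimes> ((x \<otimes> y) \<otimes> x)"
      using assms y s_comm[OF assms] by (metis m_assoc m_closed s_closed)
    also have "\<dots> = y \<otimes> (x \<otimes> x)" unfolding * using assms y by (simp add: m_assoc s_cancel)
    finally show ?thesis .
  qed
qed (use assms in simp)

lemma center_pow: "z \<in> Z \<Longrightarrow> z [^] (n::nat) \<in> Z"
  using subgroup_center by (induction n) (auto simp: subgroup.one_closed subgroup.m_closed)

lemma pow_double: "x \<in> carrier G \<Longrightarrow> x [^] (2 * n :: nat) = (x \<otimes> x) [^] n"
proof -
  assume x: "x \<in> carrier G"
  have "x [^] (2 * n) = (x [^] (Suc (Suc 0))) [^] n"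
    using x by (simp only: nat_pow_pow numeral_2_eq_2)
  then show ?thesis using x by simp
qed

lemma even_pow_center: "x \<in> carrier G \<Longrightarrow> even n \<Longrightarrow> x [^] (n::nat) \<in> Z"
  using center_pow[OF square_center] by (metis evenE pow_double)

lemma odd_pow:
  assumes "x \<in> carrier G" "odd n"
  obtains z where "z \<in> Z" "x [^] (n::nat) = z \<otimes> x"
proof -
  obtain m where "n = Suc m" "even m" using assms(2) by (cases n) auto
  then show ?thesis using that[OF even_pow_center[OF assms(1)]] by simp
qed

lemma center_mult_commute_iff:
  assumes "z \<in> Z" "x \<in> carrier G" "y \<in> carrier G"
  shows "(z \<otimes> x) \<otimes> y = y \<otimes> (z \<otimes> x) \<longleftrightarrow> x \<otimes> y = y \<otimes> x"
proof -
  have "y \<otimes> (z \<otimes> x) = z \<otimes> (y \<otimes> x)" using assms centerD by (metis m_assoc)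
  then show ?thesis using assms centerD(1) by (simp add: m_assoc)
qed

lemma center_mult_anticommute:
  assumes "z \<in> Z" "x \<in> carrier G" "y \<in> carrier G" "x \<otimes> y = s \<otimes> (y \<otimes> x)"
  shows "(z \<otimes> x) \<otimes> y = s \<otimes> (y \<otimes> (z \<otimes> x))"
  using commute[of "z \<otimes> x" y] center_mult_commute_iff[OF assms(1-3)] assms centerD(1)[OF assms(1)]
    s_mult_neq[of "y \<otimes> x"] by auto

lemma s_pow_even: "even n \<Longrightarrow> s [^] (n::nat) = \<one>"
  by (metis evenE pow_double nat_pow_one s_closed s_square)

end

section \<open>SLC-groups in which \<open>s\<close> is an even power of every noncentral element\<close>

locale SLC_even_power = SLC +
  assumes s_even_power: "g \<in> carrier G \<Longrightarrow> g \<notin> group_center G \<Longrightarrow> \<exists>k::nat. SLC_s G = g [^] (2 * k)"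
begin

text \<open>Writing the exponent as an odd number times a power of two replaces \<open>g\<close> by an odd power of
  \<open>g\<close>, which lies in the same coset of the center and has two-power order.\<close>
lemma two_power_representative:
  assumes g: "g \<in> carrier G" "g \<notin> Z"
  obtains m i :: nat where "odd m" "i > 0" "(g [^] m) [^] (2 ^ i :: nat) = s"
proof -
  obtain k :: nat where k: "s = g [^] (2 * k)" using s_even_power[OF g] by blast
  have "k \<noteq> 0" using k s_not_one by (metis mult_0_right nat_pow_0)
  then obtain i m where im: "k = 2 ^ i * m" "odd m"
    using multiplicity_decompose'[of k 2] by (metis nat_dvd_1_iff_1 numeral_eq_one_iff semiring_norm(85))
  have "(g [^] m) [^] (2 ^ Suc i :: nat) = s"
    using k im(1) g(1) by (simp add: nat_pow_pow mult_ac)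
  then show ?thesis using that im by blast
qed

lemma odd_pow_not_center:
  assumes "g \<in> carrier G" "g \<notin> Z" "odd (m::nat)" shows "g [^] m \<notin> Z"
proof -
  obtain z where z: "z \<in> Z" "g [^] m = z \<otimes> g" using odd_pow[OF assms(1,3)] .
  obtain y where y: "y \<in> carrier G" "g \<otimes> y = s \<otimes> (y \<otimes> g)" using not_center_anticommute[OF assms(1,2)] .
  show ?thesis
    using anticommute_imp_not_center(1)[OF _ y(1) center_mult_anticommute[OF z(1) assms(1) y]]
      z centerD(1) assms(1) by simp
qed

text \<open>Choose a noncentral \<open>a\<close> with \<open>a\<close> to the power \<open>2\<^sup>j\<close> equal to \<open>s\<close> and \<open>j \<ge> 1\<close> minimal. By minimality no noncentral \<open>c\<close>
  has order dividing \<open>2\<^sup>j\<close> (\<open>no_short\<close>). Let \<open>b\<close> not commute with \<open>a\<close> and have power \<open>2\<^sup>i\<close> equal to \<open>s\<close>, where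
  \<open>i \<ge> j\<close>. If \<open>i > j\<close>, an even, hence central, power of \<open>b\<close> times \<open>a\<close> is such a \<open>c\<close>; so \<open>i = j\<close>. If
  \<open>j > 1\<close>, then \<open>b a\<close> is such a \<open>c\<close>, because \<open>(b a)\<^sup>2 = s b\<^sup>2 a\<^sup>2\<close>; so \<open>j = 1\<close>.\<close>
lemma quaternion_generators:
  obtains a b where "a \<in> carrier G" "b \<in> carrier G" "a \<otimes> a = s" "b \<otimes> b = s" "a \<otimes> b = s \<otimes> (b \<otimes> a)"
proof -
  define P where "P i \<longleftrightarrow> i > 0 \<and> (\<exists>a\<in>carrier G. a \<notin> Z \<and> a [^] (2 ^ i :: nat) = s)" for i :: nat
  have PI: "P i" if "g \<in> carrier G" "g \<notin> Z" "odd m" "i > 0" "(g [^] m) [^] (2 ^ i :: nat) = s" for g and m i :: nat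
    using that odd_pow_not_center[of g m] by (auto simp: P_def)
  obtain g where g: "g \<in> carrier G" "g \<notin> Z" using exists_not_center .
  have ex: "\<exists>i. P i" using two_power_representative[OF g] PI[OF g] by metis
  define j where "j = (LEAST i. P i)"
  have Pj: "P j" and jmin: "\<And>i. P i \<Longrightarrow> j \<le> i"
    using ex by (auto simp: j_def intro: LeastI_ex Least_le)
  obtain a where a: "a \<in> carrier G" "a \<notin> Z" "a [^] (2 ^ j :: nat) = s" and j: "j > 0"
    using Pj by (auto simp: P_def)
  have no_short: False if c: "c \<in> carrier G" "c \<notin> Z" "c [^] (2 ^ j :: nat) = \<one>" for c
  proof -
    obtain m i :: nat where mi: "odd m" "i > 0" "(c [^] m) [^] (2 ^ i :: nat) = s"
      using two_power_representative[OF c(1,2)] .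
    then have "j \<le> i" using PI[OF c(1,2)] jmin by blast
    then have "m * 2 ^ i = 2 ^ j * (m * 2 ^ (i - j))" by (simp flip: power_add)
    then have "s = (c [^] (2 ^ j :: nat)) [^] (m * 2 ^ (i - j))"
      using mi(3) c(1) by (metis nat_pow_pow)
    then show False using c(3) s_not_one by simp
  qed
  obtain b0 where b0: "b0 \<in> carrier G" "a \<otimes> b0 = s \<otimes> (b0 \<otimes> a)"
    using not_center_anticommute[OF a(1,2)] .
  have b0Z: "b0 \<notin> Z" using anticommute_imp_not_center(2)[OF a(1) b0] .
  obtain m i :: nat where mi: "odd m" "i > 0" "(b0 [^] m) [^] (2 ^ i :: nat) = s"
    using two_power_representative[OF b0(1) b0Z] .
  have ij: "j \<le> i" using PI[OF b0(1) b0Z mi] jmin by blast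
  define b where "b = b0 [^] m"
  have b: "b \<in> carrier G" "b [^] (2 ^ i :: nat) = s" using b0 mi by (auto simp: b_def)
  have "b0 \<otimes> a = s \<otimes> (a \<otimes> b0)" using b0 a(1) by (simp add: s_cancel)
  then have ba: "b \<otimes> a = s \<otimes> (a \<otimes> b)"
    using odd_pow[of b0 m] b0(1) mi(1) center_mult_anticommute[OF _ b0(1) a(1)] by (metis b_def)
  then have ab: "a \<otimes> b = s \<otimes> (b \<otimes> a)" using a(1) b(1) by (simp add: s_cancel)
  have "i = j"
  proof (rule ccontr)
    assume "i \<noteq> j"
    then have "even (2 ^ (i - j) :: nat)" using ij by simp
    then have dZ: "b [^] (2 ^ (i - j) :: nat) \<in> Z" using even_pow_center b(1) by blast
    define d where "d = b [^] (2 ^ (i - j) :: nat)"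
    have d: "d \<in> Z" "d \<in> carrier G" using dZ centerD(1) by (auto simp: d_def)
    have "d [^] (2 ^ j :: nat) = s"
      using b ij by (simp add: d_def nat_pow_pow flip: power_add)
    then have "(d \<otimes> a) [^] (2 ^ j :: nat) = \<one>"
      using pow_mult_distrib[of d a "2 ^ j"] d a centerD(2)[OF d(1) a(1)] by (simp add: s_square)
    moreover have "d \<otimes> a \<notin> Z"
      using anticommute_imp_not_center(1)[OF _ b0(1) center_mult_anticommute[OF d(1) a(1) b0]] d a by simp
    ultimately show False using no_short[of "d \<otimes> a"] d a by simp
  qed
  have "j = 1"
  proof (rule ccontr)
    assume "j \<noteq> 1"
    then obtain l where l: "j = Suc l" "even (2 ^ l :: nat)" using j by (cases j) auto
    define e f where "e = b \<otimes> b" and "f = a \<otimes> a"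
    have ef: "e \<in> Z" "f \<in> Z" "e \<in> carrier G" "f \<in> carrier G"
      using square_center a(1) b(1) by (auto simp: e_def f_def)
    have "(b \<otimes> a) \<otimes> (b \<otimes> a) = b \<otimes> (a \<otimes> b) \<otimes> a" using a(1) b(1) by (simp add: m_assoc)
    also have "\<dots> = b \<otimes> s \<otimes> (b \<otimes> a \<otimes> a)" unfolding ab using a(1) b(1) by (simp add: m_assoc)
    also have "\<dots> = s \<otimes> (e \<otimes> f)"
      unfolding s_comm[OF b(1)] e_def f_def using a(1) b(1) by (simp add: m_assoc)
    finally have sq: "(b \<otimes> a) \<otimes> (b \<otimes> a) = s \<otimes> (e \<otimes> f)" .
    have "(b \<otimes> a) [^] (2 ^ j :: nat) = (s \<otimes> (e \<otimes> f)) [^] (2 ^ l :: nat)"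
      using pow_double[of "b \<otimes> a" "2 ^ l"] a(1) b(1) sq l(1) by simp
    also have "\<dots> = s [^] (2 ^ l :: nat) \<otimes> (e [^] (2 ^ l :: nat) \<otimes> f [^] (2 ^ l :: nat))"
      using pow_mult_distrib[of s "e \<otimes> f" "2 ^ l"] pow_mult_distrib[of e f "2 ^ l"] ef
        centerD(2)[OF s_center, of "e \<otimes> f"] centerD(2)[of e f] by simp
    also have "e [^] (2 ^ l :: nat) = s"
      using pow_double[OF b(1), of "2 ^ l"] b(2) l(1) \<open>i = j\<close> by (simp add: e_def)
    also have "f [^] (2 ^ l :: nat) = s"
      using pow_double[OF a(1), of "2 ^ l"] a(3) l(1) by (simp add: f_def)
    finally have "(b \<otimes> a) [^] (2 ^ j :: nat) = \<one>" using s_pow_even[OF l(2)] by (simp add: s_square)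
    moreover have "(b \<otimes> a) \<otimes> a = s \<otimes> (a \<otimes> (b \<otimes> a))"
      unfolding ba using a(1) b(1) ba s_comm[OF a(1)] by (simp add: m_assoc)
    then have "b \<otimes> a \<notin> Z" using anticommute_imp_not_center(1)[of "b \<otimes> a" a] a(1) b(1) by simp
    ultimately show False using no_short[of "b \<otimes> a"] a b by simp
  qed
  have sq: "x \<otimes> x = s" if "x \<in> carrier G" "x [^] (2 ^ 1 :: nat) = s" for x
    using pow_double[OF that(1), of 1] that by simp
  show ?thesis
    using that[OF a(1) b(1) sq[OF a(1)] sq[OF b(1)] ab] a(3) b(2) \<open>i = j\<close> \<open>j = 1\<close> by simp
qed

text \<open>If \<open>z\<^sup>2 = s\<close>, the noncentral element \<open>z a\<close> would have square \<open>1\<close>.\<close>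
lemma center_not_square:
  assumes z: "z \<in> Z" shows "z \<otimes> z \<noteq> s"
proof
  assume zz: "z \<otimes> z = s"
  obtain a b where ab: "a \<in> carrier G" "b \<in> carrier G" "a \<otimes> a = s" "a \<otimes> b = s \<otimes> (b \<otimes> a)"
    using quaternion_generators by metis
  have za: "z \<otimes> a \<in> carrier G" "z \<otimes> a \<notin> Z"
    using anticommute_imp_not_center(1)[OF _ ab(2) center_mult_anticommute[OF z ab(1,2,4)]]
      centerD(1)[OF z] ab(1) by auto
  have "(z \<otimes> a) \<otimes> (z \<otimes> a) = (z \<otimes> z) \<otimes> (a \<otimes> a)"
    using centerD[OF z] ab(1) by (metis m_assoc m_closed)
  then have "(z \<otimes> a) \<otimes> (z \<otimes> a) = \<one>" by (simp add: zz ab s_square)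
  then show False using s_even_power[OF za] pow_double[OF za(1)] s_not_one by auto
qed

text \<open>Since \<open>s\<close> is not a square in the center, Zorn's lemma gives a subgroup \<open>A\<close> of the center
  that is maximal among those containing the squares of all central elements but not \<open>s\<close>. For central \<open>z \<notin> A\<close> the set
  \<open>A \<union> A z\<close> is a subgroup because \<open>z\<^sup>2 \<in> A\<close>, so it contains \<open>s\<close>, and \<open>s z \<in> A\<close> follows.\<close>
lemma center_complement:
  obtains A where "subgroup A G" "A \<subseteq> Z" "s \<notin> A" "\<And>z. z \<in> Z \<Longrightarrow> z \<in> A \<or> s \<otimes> z \<in> A"
proof -
  define \<A> where "\<A> = {A. subgroup A G \<and> A \<subseteq> Z \<and> s \<notin> A \<and> (\<forall>z\<in>Z. z \<otimes> z \<in> A)}"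
  define S where "S = (\<lambda>z. z \<otimes> z) ` Z"
  have "S \<in> \<A>"
  proof -
    have "subgroup S G"
    proof (rule subgroupI)
      show "S \<subseteq> carrier G" using centerD(1) by (auto simp: S_def)
      show "S \<noteq> {}" using s_center by (auto simp: S_def)
      show "inv x \<in> S" if x: "x \<in> S" for x
      proof -
        obtain z where "z \<in> Z" "x = z \<otimes> z" using x by (auto simp: S_def)
        then show ?thesis using subgroup.m_inv_closed[OF subgroup_center] centerD(1)
          by (auto simp: S_def inv_mult_group)
      qed
      show "x \<otimes> y \<in> S" if x: "x \<in> S" and y: "y \<in> S" for x y
      proof -
        obtain z where z: "z \<in> Z" "x = z \<otimes> z" using x by (auto simp: S_def)
        obtain w where w: "w \<in> Z" "y = w \<otimes> w" using y by (auto simp: S_def)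
        have "x \<otimes> y = (z \<otimes> w) \<otimes> (z \<otimes> w)"
          using z w centerD(2)[OF z(1), of w] centerD(1)[OF z(1)] centerD(1)[OF w(1)]
          by (metis m_assoc m_closed)
        then show ?thesis using subgroup.m_closed[OF subgroup_center z(1) w(1)] by (auto simp: S_def)
      qed
    qed
    moreover have "S \<subseteq> Z" using subgroup.m_closed[OF subgroup_center] by (auto simp: S_def)
    moreover have "s \<notin> S" unfolding S_def image_iff using center_not_square by metis
    ultimately show ?thesis by (auto simp: \<A>_def S_def)
  qed
  then have "\<A> \<noteq> {}" by blast
  moreover have "\<Union>\<C> \<in> \<A>" if C: "\<C> \<noteq> {}" "subset.chain \<A> \<C>" for \<C>
  proof -
    have sub: "A \<in> \<A>" if "A \<in> \<C>" for A using C that by (auto simp: subset.chain_def)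
    have "subgroup (\<Union>\<C>) G"
    proof (rule subgroupI)
      show "\<Union>\<C> \<subseteq> carrier G" using sub subgroup.subset by (fastforce simp: \<A>_def)
      show "\<Union>\<C> \<noteq> {}" using C(1) sub subgroup.one_closed by (fastforce simp: \<A>_def)
      show "inv x \<in> \<Union>\<C>" if "x \<in> \<Union>\<C>" for x
        using that sub subgroup.m_inv_closed by (fastforce simp: \<A>_def)
      show "x \<otimes> y \<in> \<Union>\<C>" if xy: "x \<in> \<Union>\<C>" "y \<in> \<Union>\<C>" for x y
      proof -
        obtain A B where AB: "A \<in> \<C>" "B \<in> \<C>" "x \<in> A" "y \<in> B" using xy by blast
        then have "A \<subseteq> B \<or> B \<subseteq> A" using C(2) by (auto simp: subset.chain_def)
        then obtain D where "D \<in> \<C>" "x \<in> D" "y \<in> D" using AB by blast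
        then show ?thesis using sub[of D] subgroup.m_closed[of D G x y] by (auto simp: \<A>_def)
      qed
    qed
    then show ?thesis using C(1) sub by (fastforce simp: \<A>_def)
  qed
  ultimately obtain A where A: "A \<in> \<A>" and max: "\<And>B. B \<in> \<A> \<Longrightarrow> A \<subseteq> B \<Longrightarrow> B = A"
    using subset_Zorn_nonempty[of \<A>] by blast
  have sA: "subgroup A G" "A \<subseteq> Z" "s \<notin> A" and sq: "\<And>z. z \<in> Z \<Longrightarrow> z \<otimes> z \<in> A"
    using A by (auto simp: \<A>_def)
  note Acar = subgroup.mem_carrier[OF sA(1)]
  have "s \<otimes> z \<in> A" if z: "z \<in> Z" "z \<notin> A" for z
  proof -
    note zc = centerD(1)[OF z(1)]
    \<comment> \<open>The subgroup generated by \<open>A\<close> and \<open>z\<close>, since \<open>z\<^sup>2 \<in> A\<close>.\<close>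
    define B where "B = A \<union> (\<lambda>x. x \<otimes> z) ` A"
    have BZ: "B \<subseteq> Z" using sA(2) z(1) subgroup.m_closed[OF subgroup_center] by (auto simp: B_def)
    have zinv: "inv z = inv (z \<otimes> z) \<otimes> z" using zc by (simp add: inv_mult_group m_assoc)
    have "subgroup B G"
    proof (rule subgroupI)
      show "B \<subseteq> carrier G" using BZ centerD(1) by auto
      show "B \<noteq> {}" using subgroup.one_closed[OF sA(1)] by (auto simp: B_def)
      show "inv x \<in> B" if x: "x \<in> B" for x
      proof (cases "x \<in> A")
        case True
        then show ?thesis using subgroup.m_inv_closed[OF sA(1)] by (simp add: B_def)
      next
        case False
        then obtain y where y: "y \<in> A" "x = y \<otimes> z" using x by (auto simp: B_def)
        have yc: "y \<in> Z" "y \<in> carrier G" using y(1) sA(2) centerD(1) by auto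
        have "inv x = inv y \<otimes> inv z"
          using y(2) yc zc centerD(2)[OF yc(1) zc] by (simp add: inv_mult_group)
        also have "\<dots> = (inv y \<otimes> inv (z \<otimes> z)) \<otimes> z" using zinv yc zc by (simp add: m_assoc)
        finally show ?thesis
          using subgroup.m_closed[OF sA(1) subgroup.m_inv_closed[OF sA(1) y(1)]
            subgroup.m_inv_closed[OF sA(1) sq[OF z(1)]]] by (auto simp: B_def)
      qed
      show "x \<otimes> y \<in> B" if x: "x \<in> B" and y: "y \<in> B" for x y
      proof -
        obtain x' e where x': "x' \<in> A" "x = x' \<otimes> e" "e \<in> {\<one>, z}"
        proof (cases "x \<in> A")
          case True
          then show ?thesis using that[of x \<one>] Acar by simp
        next
          case False
          then show ?thesis using that[of _ z] x by (auto simp: B_def)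
        qed
        obtain y' d where y': "y' \<in> A" "y = y' \<otimes> d" "d \<in> {\<one>, z}"
        proof (cases "y \<in> A")
          case True
          then show ?thesis using that[of y \<one>] Acar by simp
        next
          case False
          then show ?thesis using that[of _ z] y by (auto simp: B_def)
        qed
        have ed: "e \<in> Z" "e \<in> carrier G" "d \<in> carrier G"
          using x'(3) y'(3) z(1) zc subgroup.one_closed[OF subgroup_center] by auto
        have "x \<otimes> y = x' \<otimes> (e \<otimes> y') \<otimes> d" using x' y' ed Acar by (simp add: m_assoc)
        also have "\<dots> = (x' \<otimes> y') \<otimes> (e \<otimes> d)"
          using centerD(2)[OF ed(1) Acar[OF y'(1)]] x' y' ed Acar by (simp add: m_assoc)
        finally have xy: "x \<otimes> y = (x' \<otimes> y') \<otimes> (e \<otimes> d)" .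
        have m: "x' \<otimes> y' \<in> A" "(x' \<otimes> y') \<otimes> (z \<otimes> z) \<in> A"
          using x' y' sq[OF z(1)] subgroup.m_closed[OF sA(1)] by auto
        then show ?thesis unfolding xy using x'(3) y'(3) zc Acar[OF m(1)] by (auto simp: B_def)
      qed
    qed
    moreover have "A \<subset> B"
    proof -
      have "z \<in> B" using zc subgroup.one_closed[OF sA(1)] by (force simp: B_def image_iff)
      then show ?thesis using z(2) by (auto simp: B_def)
    qed
    ultimately have "s \<in> B" using max[of B] BZ sq by (auto simp: \<A>_def B_def)
    then obtain y where y: "y \<in> A" "s = y \<otimes> z" using sA(3) by (auto simp: B_def)
    have "s \<otimes> z = y \<otimes> (z \<otimes> z)" using y zc Acar by (simp add: m_assoc)
    then show ?thesis using subgroup.m_closed[OF sA(1) y(1) sq[OF z(1)]] by simp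
  qed
  then show ?thesis using that[OF sA] by blast
qed

text \<open>The noncentral element \<open>g = x a\<close> has \<open>g\<^sup>2 = x\<^sup>2 s\<close>, whose square is \<open>1\<close>, so the only
  candidate for a power of \<open>g\<^sup>2\<close> equal to \<open>s\<close> is \<open>g\<^sup>2\<close> itself.\<close>
lemma center_no_order_four:
  assumes x: "x \<in> Z" "x [^] (4::nat) = \<one>"
  shows "x \<otimes> x = \<one>"
proof -
  have xc: "x \<in> Z" "x \<in> carrier G" using x centerD(1) by auto
  obtain a b where ab: "a \<in> carrier G" "b \<in> carrier G" "a \<otimes> a = s" "a \<otimes> b = s \<otimes> (b \<otimes> a)"
    using quaternion_generators by metis
  define g where "g = x \<otimes> a"
  have g: "g \<in> carrier G" "g \<notin> Z"
    using anticommute_imp_not_center(1)[OF _ ab(2) center_mult_anticommute[OF xc(1) ab(1,2,4)]]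
      xc ab(1) by (auto simp: g_def)
  have gg: "g \<otimes> g = (x \<otimes> x) \<otimes> s"
    using centerD(2)[OF xc(1) ab(1)] xc ab(1,3) unfolding g_def by (metis m_assoc m_closed)
  have "(x \<otimes> x) \<otimes> (x \<otimes> x) = \<one>"
    using x(2) xc(2) pow_double[OF xc(2), of 2] pow_double[of "x \<otimes> x" 1] by simp
  then have gggg: "(g \<otimes> g) \<otimes> (g \<otimes> g) = \<one>"
    using xc(2) s_comm[of "x \<otimes> x"] pow_mult_distrib[of "x \<otimes> x" s "2::nat"] unfolding gg
    by (metis m_assoc m_closed r_one s_closed s_square)
  obtain k where "s = g [^] (2 * k :: nat)" using s_even_power[OF g] by blast
  then have k: "s = (g \<otimes> g) [^] k" using pow_double g(1) by simp
  have ev: "(g \<otimes> g) [^] (2 * m :: nat) = \<one>" for m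
    using pow_double[of "g \<otimes> g" m] gggg g(1) by simp
  show ?thesis
  proof (cases "even k")
    case True
    then show ?thesis using k ev s_not_one by (metis evenE)
  next
    case False
    then obtain m where "k = Suc (2 * m)" by (metis oddE Suc_eq_plus1)
    then have "s = (x \<otimes> x) \<otimes> s" using k ev[of m] g(1) gg xc(2) by simp
    then show ?thesis using xc(2) by (metis m_closed r_cancel_one' s_closed)
  qed
qed

end

section \<open>The decomposition of an SLC-group along its quaternion subgroup\<close>

context SLC
begin

text \<open>The four elements are told apart modulo the center by whether they commute with \<open>a\<close> and
  with \<open>b\<close>, and the center has index \<open>4\<close>.\<close>
lemma center_cosets:
  assumes ab: "a \<in> carrier G" "b \<in> carrier G" "a \<otimes> b = s \<otimes> (b \<otimes> a)" and x: "x \<in> carrier G"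
  obtains z q where "z \<in> Z" "q \<in> {\<one>, a, b, a \<otimes> b}" "x = z \<otimes> q"
proof -
  interpret Z: normal Z G using normal_group_center[OF is_group] .
  define Q where "Q = {\<one>, a, b, a \<otimes> b}"
  have Qc: "Q \<subseteq> carrier G" using ab by (auto simp: Q_def)
  have ab_ne: "a \<otimes> b \<noteq> b \<otimes> a" using ab s_mult_neq[of "b \<otimes> a"] by simp
  have inv: "(x \<otimes> w = w \<otimes> x) = (y \<otimes> w = w \<otimes> y)"
    if "Z #> x = Z #> y" "x \<in> carrier G" "y \<in> carrier G" "w \<in> carrier G" for x y w
  proof -
    have "x \<in> Z #> y" using rcos_self[OF that(2) subgroup_center] that(1) by simp
    then obtain z where "z \<in> Z" "x = z \<otimes> y" by (auto simp: r_coset_def)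
    then show ?thesis using center_mult_commute_iff that by simp
  qed
  have aba: "a \<otimes> b \<otimes> a \<noteq> a \<otimes> (a \<otimes> b)" "a \<otimes> b \<otimes> b \<noteq> b \<otimes> (a \<otimes> b)"
    using ab(1,2) ab_ne by (simp add: m_assoc) (metis ab(1,2) ab_ne m_assoc m_closed r_cancel)
  have inj: "inj_on (\<lambda>q. Z #> q) Q"
  proof (rule inj_onI)
    fix q r assume qr: "q \<in> Q" "r \<in> Q" "Z #> q = Z #> r"
    have "(q \<otimes> a = a \<otimes> q) = (r \<otimes> a = a \<otimes> r)" "(q \<otimes> b = b \<otimes> q) = (r \<otimes> b = b \<otimes> r)"
      using inv[OF qr(3)] qr(1,2) Qc ab by auto
    then show "q = r"
      using qr(1,2) ab(1,2) ab_ne ab_ne[symmetric] aba unfolding Q_def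
      by (elim insertE emptyE) (simp_all del: m_assoc)
  qed
  have "card Q = 4"
  proof -
    have "\<one> \<noteq> a" "\<one> \<noteq> b" "a \<noteq> b" using ab ab_ne by auto
    moreover have "\<one> \<noteq> a \<otimes> b"
      using aba(1) ab by (metis l_one r_one)
    moreover have "a \<noteq> a \<otimes> b" "b \<noteq> a \<otimes> b" using aba by auto
    ultimately show ?thesis by (simp add: Q_def)
  qed
  then have cQ: "card ((\<lambda>q. Z #> q) ` Q) = 4" using card_image[OF inj] by simp
  obtain h where "h \<in> iso (G Mod Z) (integer_mod_group 2 \<times>\<times> integer_mod_group 2)"
    using SLC by (auto simp: SLC_group_def is_iso_def)
  then have bij: "bij_betw h (carrier (G Mod Z)) ({0..<2::int} \<times> {0..<2})"
    by (auto simp: iso_def carrier_integer_mod_group)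
  then have "card (carrier (G Mod Z)) = 4" "finite (carrier (G Mod Z))"
    using bij_betw_same_card[OF bij] bij_betw_finite[OF bij] by auto
  moreover have "(\<lambda>q. Z #> q) ` Q \<subseteq> carrier (G Mod Z)"
    using Qc by (auto simp: FactGroup_def RCOSETS_def)
  ultimately have "(\<lambda>q. Z #> q) ` Q = carrier (G Mod Z)" using cQ by (intro card_seteq) auto
  moreover have "Z #> x \<in> carrier (G Mod Z)" using x by (auto simp: FactGroup_def RCOSETS_def)
  ultimately obtain q where q: "q \<in> Q" "Z #> x = Z #> q" by (metis imageE)
  have "x \<in> Z #> q" using rcos_self[OF x subgroup_center] q by simp
  then obtain z where "z \<in> Z" "x = z \<otimes> q" by (auto simp: r_coset_def)
  then show ?thesis using that q(1) by (simp add: Q_def)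
qed

end

text \<open>A subgroup as a plain \<open>monoid\<close> record; the update \<open>G\<lparr>carrier := A\<rparr>\<close> would keep the record extension
  of \<open>G\<close> in its type.\<close>
definition subgroup_monoid :: "('g, 'm) monoid_scheme \<Rightarrow> 'g set \<Rightarrow> 'g monoid" where
  "subgroup_monoid G A = \<lparr>carrier = A, monoid.mult = monoid.mult G, monoid.one = monoid.one G\<rparr>"

lemma (in group) group_subgroup_monoid:
  assumes "subgroup A G" shows "group (subgroup_monoid G A)"
proof (rule groupI)
  fix x :: 'a assume "x \<in> carrier (subgroup_monoid G A)"
  then show "\<exists>y\<in>carrier (subgroup_monoid G A). y \<otimes>\<^bsub>subgroup_monoid G A\<^esub> x = \<one>\<^bsub>subgroup_monoid G A\<^esub>"
    using subgroup.m_inv_closed[OF assms] subgroup.mem_carrier[OF assms]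
    by (intro bexI[of _ "inv x"]) (auto simp: subgroup_monoid_def)
qed (use assms subgroup.mem_carrier[OF assms] in
    \<open>auto simp: subgroup_monoid_def m_assoc subgroup.m_closed subgroup.one_closed\<close>)

lemma (in group) pow_subgroup_monoid: "x [^]\<^bsub>subgroup_monoid G A\<^esub> (n::nat) = x [^] n"
  by (simp add: nat_pow_def subgroup_monoid_def)

context SLC
begin

text \<open>The map \<open>\<psi>\<close> embeds \<open>Q\<^sub>8\<close> by \<open>-1 \<mapsto> s\<close>, \<open>i \<mapsto> a\<close>, \<open>j \<mapsto> b\<close>; the sum of the four
  coordinates of an element of \<open>Q\<^sub>8\<close> is its sign. The isomorphism is \<open>(q, x) \<mapsto> \<psi>(q) x\<close>.\<close>
lemma iso_Q8_times_complement:
  assumes ab: "a \<in> carrier G" "b \<in> carrier G" "a \<otimes> a = s" "b \<otimes> b = s" "a \<otimes> b = s \<otimes> (b \<otimes> a)"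
    and A: "subgroup A G" "A \<subseteq> Z" "s \<notin> A" "\<And>z. z \<in> Z \<Longrightarrow> z \<in> A \<or> s \<otimes> z \<in> A"
  shows "G \<cong> Q8 \<times>\<times> subgroup_monoid G A"
proof -
  define \<psi> :: "int \<times> int \<times> int \<times> int \<Rightarrow> 'a" where "\<psi> = (\<lambda>(t, i, j, k).
    (if t + i + j + k < 0 then s else \<one>) \<otimes>
    (if i \<noteq> 0 then a else if j \<noteq> 0 then b else if k \<noteq> 0 then a \<otimes> b else \<one>))"
  have car: "\<psi> q \<in> carrier G" for q using ab by (auto simp: \<psi>_def split: prod.splits)
  have Acar: "x \<in> carrier G" if "x \<in> A" for x using subgroup.mem_carrier[OF A(1) that] .
  have ba: "b \<otimes> a = s \<otimes> (a \<otimes> b)" using ab by (simp add: s_cancel)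
  have l: "a \<otimes> (a \<otimes> x) = s \<otimes> x" "b \<otimes> (b \<otimes> x) = s \<otimes> x" "b \<otimes> (a \<otimes> x) = s \<otimes> (a \<otimes> (b \<otimes> x))"
    "a \<otimes> (s \<otimes> x) = s \<otimes> (a \<otimes> x)" "b \<otimes> (s \<otimes> x) = s \<otimes> (b \<otimes> x)" if "x \<in> carrier G" for x
    using that ab(1,2) ab(3,4) ba s_comm[OF ab(1)] s_comm[OF ab(2)] by (metis m_assoc m_closed s_closed)+
  have \<psi>: "\<psi> (hamilton_mult q r) = \<psi> q \<otimes> \<psi> r" if "q \<in> carrier Q8" "r \<in> carrier Q8" for q r
    using that ab(1,2) unfolding Q8_def
    by (auto simp: \<psi>_def m_assoc l ab(3,4) ba s_comm s_cancel s_square)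
  define \<Psi> where "\<Psi> = (\<lambda>(q, x). \<psi> q \<otimes> x)"
  define M where "M = Q8 \<times>\<times> subgroup_monoid G A"
  have M: "group M" unfolding M_def
    by (intro DirProd_group group_Q8 group_subgroup_monoid A)
  have hom: "\<Psi> \<in> hom M G"
  proof (rule homI)
    fix u v assume "u \<in> carrier M" "v \<in> carrier M"
    then obtain q x r y where uv: "u = (q, x)" "v = (r, y)" "q \<in> carrier Q8" "r \<in> carrier Q8" "x \<in> A" "y \<in> A"
      by (auto simp: M_def subgroup_monoid_def DirProd_def)
    have "x \<otimes> \<psi> r = \<psi> r \<otimes> x" using centerD(2)[OF _ car, of x r] A(2) uv(5) by blast
    then have "\<psi> q \<otimes> \<psi> r \<otimes> (x \<otimes> y) = \<psi> q \<otimes> x \<otimes> (\<psi> r \<otimes> y)"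
      using car Acar[OF uv(5)] Acar[OF uv(6)] by (metis m_assoc m_closed)
    then show "\<Psi> (u \<otimes>\<^bsub>M\<^esub> v) = \<Psi> u \<otimes> \<Psi> v"
      using uv \<psi> by (simp add: \<Psi>_def M_def subgroup_monoid_def Q8_def)
  qed (use car Acar in \<open>auto simp: \<Psi>_def M_def subgroup_monoid_def DirProd_def\<close>)
  interpret \<Psi>: group_hom M G \<Psi>
    using M hom by (simp add: group_hom_def group_hom_axioms_def)
  have notZ: "a \<notin> Z" "b \<notin> Z" "a \<otimes> b \<notin> Z"
  proof -
    show "a \<notin> Z" "b \<notin> Z" using anticommute_imp_not_center[OF ab(1,2,5)] by auto
    have "(a \<otimes> b) \<otimes> b = s \<otimes> (b \<otimes> (a \<otimes> b))" using ab(1,2) l s_cancel ba ab(5) by (simp add: m_assoc)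
    then show "a \<otimes> b \<notin> Z" using anticommute_imp_not_center(1)[of "a \<otimes> b" b] ab by simp
  qed
  have sZ: "x \<in> Z" if "s \<otimes> x \<in> Z" "x \<in> carrier G" for x
    using subgroup.m_closed[OF subgroup_center s_center that(1)] that(2) by (simp add: s_cancel)
  have inj: "inj_on \<Psi> (carrier M)"
    unfolding \<Psi>.inj_on_one_iff
  proof (intro allI impI)
    fix u assume "u \<in> carrier M" and u1: "\<Psi> u = \<one>"
    then obtain q x where u: "u = (q, x)" "q \<in> carrier Q8" "x \<in> A"
      by (auto simp: M_def subgroup_monoid_def DirProd_def)
    have "\<psi> q = inv x" using u1 u car Acar by (simp add: \<Psi>_def inv_equality)
    then have "\<psi> q \<in> A" using subgroup.m_inv_closed[OF A(1) u(3)] by simp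
    moreover have "\<psi> q \<notin> A" if "q \<noteq> (1, 0, 0, 0)"
      using u(2) that A(2,3) notZ sZ[of a] sZ[of b] sZ[of "a \<otimes> b"] ab(1,2)
      by (auto simp: \<psi>_def Q8_def)
    ultimately have q: "q = (1, 0, 0, 0)" by blast
    then have "x = \<one>" using u1 u Acar by (simp add: \<Psi>_def \<psi>_def)
    then show "u = \<one>\<^bsub>M\<^esub>" using q u by (simp add: M_def subgroup_monoid_def Q8_def)
  qed
  have "carrier G \<subseteq> \<Psi> ` carrier M"
  proof
    fix x assume "x \<in> carrier G"
    then obtain z q where zq: "z \<in> Z" "q \<in> {\<one>, a, b, a \<otimes> b}" "x = z \<otimes> q"
      using center_cosets[OF ab(1,2,5)] by metis
    have qc: "q \<in> carrier G" using zq ab by auto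
    obtain y t where y: "y \<in> A" "t \<in> {\<one>, s}" "z = t \<otimes> y"
    proof (cases "z \<in> A")
      case True then show ?thesis using that[of z \<one>] Acar by simp
    next
      case False
      then have "s \<otimes> z \<in> A" using A(4) zq(1) by blast
      then show ?thesis using that[of "s \<otimes> z" s] centerD(1)[OF zq(1)] by (simp add: s_cancel)
    qed
    have tc: "t \<in> carrier G" using y by auto
    have "x = (t \<otimes> q) \<otimes> y"
      unfolding zq(3) y(3) using centerD(2)[of y q] A(2) y(1) qc tc Acar by (auto simp: m_assoc)
    moreover have "\<exists>r\<in>carrier Q8. \<psi> r = t \<otimes> q"
      using y(2) zq(2) by (auto simp: \<psi>_def Q8_def)
    then obtain r where "r \<in> carrier Q8" "\<psi> r = t \<otimes> q" by blast
    ultimately show "x \<in> \<Psi> ` carrier M"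
      using y(1) by (auto simp: \<Psi>_def M_def subgroup_monoid_def DirProd_def intro!: image_eqI[of _ _ "(r, y)"])
  qed
  then have "\<Psi> \<in> iso M G"
    using inj \<Psi>.hom_closed hom by (auto simp: iso_def bij_betw_def)
  then show ?thesis using group.iso_sym[OF M] unfolding M_def is_iso_def by blast
qed

end

section \<open>Quotients of the group ring in which \<open>s\<close> becomes \<open>-1\<close>\<close>

locale SLC_algebra = group_algebra G R + SLC G for G (structure) and R (structure)
begin

text \<open>Noncommuting products \<open>x y\<close> and \<open>y x\<close> differ by \<open>s\<close> and are noncentral, and a symmetric
  element takes equal values on them.\<close>
lemma symmetric_central:
  assumes p: "p \<in> carrier RG" "linear_extension R G (canonical_involution G) p = p"
    and f: "f \<in> carrier RG"
  shows "p \<otimes>\<^bsub>RG\<^esub> f = f \<otimes>\<^bsub>RG\<^esub> p"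
proof (rule central_if_class_function[OF p(1) _ f])
  have inv: "p (s \<otimes> x) = p x" if x: "x \<in> carrier G" "x \<notin> Z" for x
  proof -
    have sx: "s \<otimes> x \<notin> Z"
      using subgroup.m_closed[OF subgroup_center s_center, of "s \<otimes> x"] x by (auto simp: s_cancel)
    have "canonical_involution G g = s \<otimes> x \<longleftrightarrow> g = x" if "g \<in> carrier G" for g
      using sx x that by (auto simp: canonical_involution_def)
    then have "{g \<in> grsupp R G p. canonical_involution G g = s \<otimes> x} = (if p x = \<zero>\<^bsub>R\<^esub> then {} else {x})"
      using x(1) by (auto simp: grsupp_def)
    then have "linear_extension R G (canonical_involution G) p (s \<otimes> x) = p x"
      using x(1) carrier_apply[OF p(1) x(1)] by (simp add: linear_extension_def)
    then show ?thesis using p(2) by simp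
  qed
  fix x y assume xy: "x \<in> carrier G" "y \<in> carrier G"
  show "p (x \<otimes> y) = p (y \<otimes> x)"
  proof (cases "x \<otimes> y = y \<otimes> x")
    case False
    then have "x \<otimes> y = s \<otimes> (y \<otimes> x)" using commute[OF xy] by simp
    moreover have "y \<otimes> x \<notin> Z" using noncommuting_product_not_center[of y x] False xy by simp
    ultimately show ?thesis using inv[of "y \<otimes> x"] xy by simp
  qed simp
qed

lemma star_clean_imp_centrally_clean:
  assumes "star_clean RG (linear_extension R G (canonical_involution G))"
  shows "centrally_clean RG"
  using assms symmetric_central unfolding star_clean_def centrally_clean_def is_projection_def
  by metis

end

context group_algebra
begin

abbreviation "emb g \<equiv> monom \<one>\<^bsub>R\<^esub> g"

lemma emb_mult: "g \<in> carrier G \<Longrightarrow> h \<in> carrier G \<Longrightarrow> emb g \<otimes>\<^bsub>RG\<^esub> emb h = emb (g \<otimes> h)"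
  by (simp add: monom_mult_monom)

lemma monom_center:
  assumes "r \<in> carrier R" "z \<in> group_center G" shows "monom r z \<in> ring_center RG"
proof -
  have zc: "z \<in> carrier G" "\<And>g. g \<in> carrier G \<Longrightarrow> z \<otimes> g = g \<otimes> z"
    using assms(2) by (auto simp: group_center_def)
  have "x \<otimes> y = z \<longleftrightarrow> y \<otimes> x = z" if "x \<in> carrier G" "y \<in> carrier G" for x y
    using noncommuting_product_not_center[of x y] noncommuting_product_not_center[of y x] that assms(2)
    by metis
  then have "monom r z \<otimes>\<^bsub>RG\<^esub> f = f \<otimes>\<^bsub>RG\<^esub> monom r z" if "f \<in> carrier RG" for f
    using that assms(1) by (intro central_if_class_function) (auto simp: monom_apply monom_closed)
  then show ?thesis using assms(1) by (simp add: ring_center_def monom_closed)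
qed

text \<open>A nonzero quotient of the group ring in which elements acting on \<open>w\<close> in the same way become
  equal, together with the properties that it inherits if the group ring is clean.\<close>
definition annihilator_quotient :: "('a \<Rightarrow> 'c) \<Rightarrow> ('a \<Rightarrow> 'c) set ring \<Rightarrow> (('a \<Rightarrow> 'c) \<Rightarrow> ('a \<Rightarrow> 'c) set) \<Rightarrow> bool"
  where "annihilator_quotient w T \<theta> \<longleftrightarrow> ring_hom_ring RG T \<theta> \<and> \<theta> ` carrier RG = carrier T \<and>
    idempotents_central T \<and> \<one>\<^bsub>T\<^esub> \<oplus>\<^bsub>T\<^esub> \<one>\<^bsub>T\<^esub> \<in> Units T \<and> \<one>\<^bsub>T\<^esub> \<noteq> \<zero>\<^bsub>T\<^esub> \<and>
    (\<forall>f\<in>carrier RG. \<forall>h\<in>carrier RG. f \<otimes>\<^bsub>RG\<^esub> w = h \<otimes>\<^bsub>RG\<^esub> w \<longrightarrow> \<theta> f = \<theta> h)"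

lemma annihilator_quotient_exists:
  assumes clean: "centrally_clean RG" and two: "\<one>\<^bsub>R\<^esub> \<oplus>\<^bsub>R\<^esub> \<one>\<^bsub>R\<^esub> \<in> Units R"
    and w: "w \<in> funs" "\<And>x y. x \<in> carrier G \<Longrightarrow> y \<in> carrier G \<Longrightarrow> w (x \<otimes> y) = w (y \<otimes> x)"
    and nz: "w \<noteq> \<zero>\<^bsub>RG\<^esub>"
  shows "\<exists>T \<theta>. annihilator_quotient w T \<theta>"
proof -
  define I where "I = {f \<in> carrier RG. f \<otimes>\<^bsub>RG\<^esub> w = \<zero>\<^bsub>RG\<^esub>}"
  define \<theta> where "\<theta> = (+>\<^bsub>RG\<^esub>) I"
  interpret I: ideal I RG unfolding I_def by (rule ideal_annihilator[OF w])
  interpret \<theta>: ring_hom_ring RG "RG Quot I" \<theta> unfolding \<theta>_def by (rule I.rcos_ring_hom_ring)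
  have zero: "\<zero>\<^bsub>RG Quot I\<^esub> = I" by (simp add: FactRing_def)
  have surj: "\<theta> ` carrier RG = carrier (RG Quot I)"
    by (simp add: \<theta>_def FactRing_def A_RCOSETS_def' UNION_singleton_eq_range)
  have "\<one>\<^bsub>RG\<^esub> \<notin> I" using nz one_mult[OF w(1)] unfolding I_def by simp
  then have one: "\<one>\<^bsub>RG Quot I\<^esub> \<noteq> \<zero>\<^bsub>RG Quot I\<^esub>"
    using I.rcos_const_imp_mem[OF I.one_closed] unfolding zero by (simp add: FactRing_def) metis
  have eq: "\<theta> f = \<theta> h" if fh: "f \<in> carrier RG" "h \<in> carrier RG" "f \<otimes>\<^bsub>RG\<^esub> w = h \<otimes>\<^bsub>RG\<^esub> w" for f h
  proof -
    define d where "d = f \<ominus>\<^bsub>RG\<^esub> h"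
    have d: "d \<in> carrier RG" using fh by (simp add: d_def)
    have fd: "f = d \<oplus>\<^bsub>RG\<^esub> h" using fh unfolding d_def by algebra
    have "d \<otimes>\<^bsub>RG\<^esub> w = \<zero>\<^bsub>RG\<^esub>"
    proof (rule funs_eqI)
      fix x assume x: "x \<in> carrier G"
      have "(d \<otimes>\<^bsub>RG\<^esub> w) x \<oplus>\<^bsub>R\<^esub> (h \<otimes>\<^bsub>RG\<^esub> w) x = (h \<otimes>\<^bsub>RG\<^esub> w) x"
        using mult_add_left[OF d fh(2) w(1)] fd fh(3) add_apply[OF x, of "d \<otimes>\<^bsub>RG\<^esub> w" "h \<otimes>\<^bsub>RG\<^esub> w"] by simp
      then show "(d \<otimes>\<^bsub>RG\<^esub> w) x = \<zero>\<^bsub>RG\<^esub> x"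
        using funs_closed[OF mult_funs[OF carrier_funs[OF d] w(1)] x]
          funs_closed[OF mult_funs[OF carrier_funs[OF fh(2)] w(1)] x] zero_apply[OF x]
        by (metis R.add.r_cancel_one')
    qed (use d w zero_closed in \<open>simp_all add: mult_funs carrier_funs\<close>)
    then have "d \<in> I" using d unfolding I_def by blast
    then have "\<theta> d = \<zero>\<^bsub>RG Quot I\<^esub>"
      unfolding zero \<theta>_def by (rule I.a_rcos_zero[OF I.ideal_axioms])
    then show ?thesis using fd d fh by simp
  qed
  have two_RG: "\<one>\<^bsub>RG\<^esub> \<oplus>\<^bsub>RG\<^esub> \<one>\<^bsub>RG\<^esub> \<in> Units RG"
  proof -
    obtain t where t: "t \<in> carrier R" "t \<otimes>\<^bsub>R\<^esub> (\<one>\<^bsub>R\<^esub> \<oplus>\<^bsub>R\<^esub> \<one>\<^bsub>R\<^esub>) = \<one>\<^bsub>R\<^esub>"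
      using two by (auto simp: Units_def)
    have sum: "\<one>\<^bsub>RG\<^esub> \<oplus>\<^bsub>RG\<^esub> \<one>\<^bsub>RG\<^esub> = monom (\<one>\<^bsub>R\<^esub> \<oplus>\<^bsub>R\<^esub> \<one>\<^bsub>R\<^esub>) \<one>"
      unfolding one_eq_monom by (rule monom_add) auto
    have "monom t \<one> \<otimes>\<^bsub>RG\<^esub> monom (\<one>\<^bsub>R\<^esub> \<oplus>\<^bsub>R\<^esub> \<one>\<^bsub>R\<^esub>) \<one> = \<one>\<^bsub>RG\<^esub>"
      "monom (\<one>\<^bsub>R\<^esub> \<oplus>\<^bsub>R\<^esub> \<one>\<^bsub>R\<^esub>) \<one> \<otimes>\<^bsub>RG\<^esub> monom t \<one> = \<one>\<^bsub>RG\<^esub>"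
      using t by (simp_all add: monom_mult_monom one_eq_monom R.m_comm)
    then show ?thesis unfolding sum Units_def using t monom_closed by auto
  qed
  have two_T: "\<one>\<^bsub>RG Quot I\<^esub> \<oplus>\<^bsub>RG Quot I\<^esub> \<one>\<^bsub>RG Quot I\<^esub> \<in> Units (RG Quot I)"
  proof -
    obtain v where v: "v \<in> carrier RG" "v \<otimes>\<^bsub>RG\<^esub> (\<one>\<^bsub>RG\<^esub> \<oplus>\<^bsub>RG\<^esub> \<one>\<^bsub>RG\<^esub>) = \<one>\<^bsub>RG\<^esub>"
        "(\<one>\<^bsub>RG\<^esub> \<oplus>\<^bsub>RG\<^esub> \<one>\<^bsub>RG\<^esub>) \<otimes>\<^bsub>RG\<^esub> v = \<one>\<^bsub>RG\<^esub>"
      using two_RG by (auto simp: Units_def)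
    have "\<theta> (v \<otimes>\<^bsub>RG\<^esub> (\<one>\<^bsub>RG\<^esub> \<oplus>\<^bsub>RG\<^esub> \<one>\<^bsub>RG\<^esub>)) = \<theta> \<one>\<^bsub>RG\<^esub>"
      "\<theta> ((\<one>\<^bsub>RG\<^esub> \<oplus>\<^bsub>RG\<^esub> \<one>\<^bsub>RG\<^esub>) \<otimes>\<^bsub>RG\<^esub> v) = \<theta> \<one>\<^bsub>RG\<^esub>" using v by simp_all
    then show ?thesis using v(1) unfolding Units_def by (auto intro!: bexI[of _ "\<theta> v"])
  qed
  have "annihilator_quotient w (RG Quot I) \<theta>"
    unfolding annihilator_quotient_def
    using \<theta>.ring_hom_ring_axioms surj idempotents_central_image[OF \<theta>.ring_hom_ring_axioms surj clean]
      two_T one eq by blast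
  then show ?thesis by blast
qed

end

context SLC_algebra
begin

text \<open>For a central subgroup \<open>N\<close> without \<open>s\<close>, annihilating this function amounts to imposing
  \<open>n = 1\<close> for \<open>n \<in> N\<close> and \<open>s = -1\<close>. It works for infinite \<open>N\<close>, where no element of the
  group ring has this annihilator.\<close>
definition signed_indicator :: "'a set \<Rightarrow> 'a \<Rightarrow> 'c" where
  "signed_indicator N =
     (\<lambda>x\<in>carrier G. if x \<in> N then \<one>\<^bsub>R\<^esub> else if s \<otimes> x \<in> N then \<ominus>\<^bsub>R\<^esub> \<one>\<^bsub>R\<^esub> else \<zero>\<^bsub>R\<^esub>)"

lemma signed_indicator_funs: "signed_indicator N \<in> funs"
  by (auto simp: signed_indicator_def funs_def)

lemma signed_indicator_commute:
  assumes N: "N \<subseteq> Z" and xy: "x \<in> carrier G" "y \<in> carrier G"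
  shows "signed_indicator N (x \<otimes> y) = signed_indicator N (y \<otimes> x)"
proof (cases "x \<otimes> y = y \<otimes> x")
  case False
  then have notZ: "x \<otimes> y \<notin> Z" "y \<otimes> x \<notin> Z"
    using noncommuting_product_not_center[of x y] noncommuting_product_not_center[of y x] xy by auto
  have "x \<otimes> y = s \<otimes> (y \<otimes> x)" "y \<otimes> x = s \<otimes> (x \<otimes> y)"
    using commute[OF xy] commute[OF xy(2,1)] False by auto
  then have "s \<otimes> (x \<otimes> y) \<notin> Z" "s \<otimes> (y \<otimes> x) \<notin> Z" using notZ by auto
  then show ?thesis using N notZ xy by (auto simp: signed_indicator_def)
qed simp

lemma signed_indicator_s:
  assumes N: "subgroup N G" "s \<notin> N" and x: "x \<in> carrier G"
  shows "signed_indicator N (s \<otimes> x) = \<ominus>\<^bsub>R\<^esub> signed_indicator N x"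
proof -
  have "\<not> (x \<in> N \<and> s \<otimes> x \<in> N)"
  proof
    assume "x \<in> N \<and> s \<otimes> x \<in> N"
    then have "(s \<otimes> x) \<otimes> inv x \<in> N" using N(1) by (simp add: subgroup.m_closed subgroup.m_inv_closed)
    then show False using x N(2) by (simp add: m_assoc)
  qed
  then show ?thesis using x by (auto simp: signed_indicator_def s_cancel)
qed

lemma signed_indicator_shift:
  assumes N: "subgroup N G" "n \<in> N" and x: "x \<in> carrier G" and nZ: "N \<subseteq> Z"
  shows "signed_indicator N (n \<otimes> x) = signed_indicator N x"
proof -
  have nc: "n \<in> carrier G" "n \<in> Z" using N nZ subgroup.mem_carrier by auto
  have iff: "n \<otimes> y \<in> N \<longleftrightarrow> y \<in> N" if y: "y \<in> carrier G" for y
  proof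
    assume "n \<otimes> y \<in> N"
    then have "inv n \<otimes> (n \<otimes> y) \<in> N" using N by (simp add: subgroup.m_closed subgroup.m_inv_closed)
    then show "y \<in> N" using nc y by (simp flip: m_assoc)
  qed (use N(2) subgroup.m_closed[OF N(1)] in auto)
  have "s \<otimes> (n \<otimes> x) = n \<otimes> (s \<otimes> x)" using nc x s_comm[OF nc(1)] by (metis m_assoc s_closed)
  then show ?thesis using iff x nc by (auto simp: signed_indicator_def)
qed

lemma signed_indicator_one: "subgroup N G \<Longrightarrow> signed_indicator N \<one> = \<one>\<^bsub>R\<^esub>"
  by (simp add: signed_indicator_def subgroup.one_closed)

end

section \<open>Consequences of cleanness\<close>

locale clean_SLC_algebra = SLC_algebra +
  assumes clean: "centrally_clean (group_ring R G)"
    and two: "\<one>\<^bsub>R\<^esub> \<oplus>\<^bsub>R\<^esub> \<one>\<^bsub>R\<^esub> \<in> Units R" and nontrivial: "\<one>\<^bsub>R\<^esub> \<noteq> \<zero>\<^bsub>R\<^esub>"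
begin

sublocale RG: ring RG by (rule ring_RG)

lemma signed_indicator_nonzero: "subgroup N G \<Longrightarrow> signed_indicator N \<noteq> \<zero>\<^bsub>RG\<^esub>"
  using signed_indicator_one[of N] zero_apply[of \<one>] nontrivial by auto

lemma annihilator_quotient_s:
  assumes q: "annihilator_quotient w T \<theta>" and w: "w \<in> funs"
    and ws: "\<And>x. x \<in> carrier G \<Longrightarrow> w (s \<otimes> x) = \<ominus>\<^bsub>R\<^esub> w x" and g: "g \<in> carrier G"
  shows "\<theta> (emb (s \<otimes> g)) = \<ominus>\<^bsub>T\<^esub> \<theta> (emb g)"
proof -
  interpret \<theta>: ring_hom_ring RG T \<theta> using q by (simp add: annihilator_quotient_def)
  have "(emb (s \<otimes> g) \<oplus>\<^bsub>RG\<^esub> emb g) \<otimes>\<^bsub>RG\<^esub> w = \<zero>\<^bsub>RG\<^esub> \<otimes>\<^bsub>RG\<^esub> w"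
  proof (rule funs_eqI)
    fix x assume x: "x \<in> carrier G"
    have "inv (s \<otimes> g) \<otimes> x = s \<otimes> (inv g \<otimes> x)"
      using g x s_comm[of "inv g"] inv_equality[OF s_square] by (simp add: inv_mult_group m_assoc)
    then show "((emb (s \<otimes> g) \<oplus>\<^bsub>RG\<^esub> emb g) \<otimes>\<^bsub>RG\<^esub> w) x = (\<zero>\<^bsub>RG\<^esub> \<otimes>\<^bsub>RG\<^esub> w) x"
      using x g w ws[of "inv g \<otimes> x"] funs_closed[OF w]
      by (simp add: mult_add_left monom_closed add_apply monom_mult_apply zero_mult zero_apply R.l_neg)
  qed (use g w in \<open>simp_all add: mult_funs carrier_funs monom_closed add_closed zero_closed\<close>)
  then have "\<theta> (emb (s \<otimes> g) \<oplus>\<^bsub>RG\<^esub> emb g) = \<theta> \<zero>\<^bsub>RG\<^esub>"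
    
    using q RG.a_closed[OF monom_closed monom_closed, OF R.one_closed R.one_closed] RG.zero_closed
    unfolding annihilator_quotient_def by blast
  then show ?thesis using \<theta>.S.minus_equality by (simp add: monom_closed)
qed

text \<open>Otherwise there is a quotient with \<open>g\<^sup>2 = 1\<close> and \<open>s = -1\<close>, in which \<open>g\<close> is a square
  root of \<open>1\<close> anticommuting with the image of any group element that does not commute with \<open>g\<close>.\<close>
lemma s_in_square_powers:
  assumes g: "g \<in> carrier G" "g \<notin> Z"
  shows "s \<in> generate G {g \<otimes> g}"
proof (rule ccontr)
  \<comment> \<open>The quotient by the annihilator of the signed indicator of \<open>N\<close> has \<open>g\<^sup>2 = 1\<close> and \<open>s = -1\<close>.\<close>
  define N where "N = generate G {g \<otimes> g}"
  assume "s \<notin> generate G {g \<otimes> g}"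
  then have sN: "s \<notin> N" by (simp add: N_def)
  have N: "subgroup N G" unfolding N_def using g by (intro generate_is_subgroup) auto
  have NZ: "N \<subseteq> Z" unfolding N_def
    using square_center[OF g(1)] by (intro generate_subgroup_incl subgroup_center) auto
  have ggN: "inv (g \<otimes> g) \<in> N" unfolding N_def by (simp add: generate.inv)
  define w where "w = signed_indicator N"
  note w = signed_indicator_funs[of N, folded w_def] signed_indicator_commute[OF NZ, folded w_def]
    signed_indicator_nonzero[OF N, folded w_def]
  note ws = signed_indicator_s[OF N sN, folded w_def]
  obtain T \<theta> where q: "annihilator_quotient w T \<theta>"
    using annihilator_quotient_exists[OF clean two w] by blast
  then have T: "ring_hom_ring RG T \<theta>" "idempotents_central T"
    "\<one>\<^bsub>T\<^esub> \<oplus>\<^bsub>T\<^esub> \<one>\<^bsub>T\<^esub> \<in> Units T" "\<one>\<^bsub>T\<^esub> \<noteq> \<zero>\<^bsub>T\<^esub>"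
    and eq: "\<And>f h. f \<in> carrier RG \<Longrightarrow> h \<in> carrier RG \<Longrightarrow> f \<otimes>\<^bsub>RG\<^esub> w = h \<otimes>\<^bsub>RG\<^esub> w \<Longrightarrow> \<theta> f = \<theta> h"
    unfolding annihilator_quotient_def by blast+
  note neg = annihilator_quotient_s[OF q w(1) ws]
  interpret \<theta>: ring_hom_ring RG T \<theta> by fact
  obtain h where h: "h \<in> carrier G" "g \<otimes> h = s \<otimes> (h \<otimes> g)" using not_center_anticommute[OF g] .
  have mult: "\<theta> (emb x) \<otimes>\<^bsub>T\<^esub> \<theta> (emb y) = \<theta> (emb (x \<otimes> y))" if "x \<in> carrier G" "y \<in> carrier G" for x y
    using that by (simp add: monom_closed emb_mult flip: \<theta>.hom_mult)
  have "emb (g \<otimes> g) \<otimes>\<^bsub>RG\<^esub> w = \<one>\<^bsub>RG\<^esub> \<otimes>\<^bsub>RG\<^esub> w"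
  proof (rule funs_eqI)
    fix x assume "x \<in> carrier G"
    then show "(emb (g \<otimes> g) \<otimes>\<^bsub>RG\<^esub> w) x = (\<one>\<^bsub>RG\<^esub> \<otimes>\<^bsub>RG\<^esub> w) x"
      using signed_indicator_funs[of N] signed_indicator_shift[OF N ggN _ NZ, of x] g(1)
        funs_closed[OF signed_indicator_funs[of N]]
      by (simp add: w_def one_mult monom_mult_apply)
  qed (simp_all add: w_def mult_funs signed_indicator_funs carrier_funs monom_closed)
  then have "\<theta> (emb (g \<otimes> g)) = \<theta> \<one>\<^bsub>RG\<^esub>" by (intro eq) (simp_all add: monom_closed)
  then have sq: "\<theta> (emb g) \<otimes>\<^bsub>T\<^esub> \<theta> (emb g) = \<one>\<^bsub>T\<^esub>" using mult[OF g(1) g(1)] by simp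
  have "\<theta> (emb g) \<otimes>\<^bsub>T\<^esub> \<theta> (emb h) = \<ominus>\<^bsub>T\<^esub> (\<theta> (emb h) \<otimes>\<^bsub>T\<^esub> \<theta> (emb g))"
    using mult[OF g(1) h(1)] mult[OF h(1) g(1)] h g(1) neg[of "h \<otimes> g"] by simp
  then have "\<theta> (emb h) = \<zero>\<^bsub>T\<^esub>"
    using \<theta>.S.square_one_anticommute[OF T(3,2) _ sq] by (simp add: monom_closed)
  moreover have "\<theta> (emb h) \<otimes>\<^bsub>T\<^esub> \<theta> (emb (inv h)) = \<one>\<^bsub>T\<^esub>"
    using mult[OF h(1) inv_closed[OF h(1)]] h(1) by (simp flip: one_eq_monom)
  ultimately show False using T(4) by (simp add: monom_closed)
qed

sublocale SLC_even_power
proof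
  fix g assume g: "g \<in> carrier G" "g \<notin> Z"
  obtain k :: int where k: "s = (g \<otimes> g) [^] k"
    using s_in_square_powers[OF g] generate_pow[of "g \<otimes> g"] g(1) by auto
  show "\<exists>k::nat. s = g [^] (2 * k)"
  proof (cases "k \<ge> 0")
    case True
    then have "s = (g \<otimes> g) [^] nat k" using k by (simp flip: int_pow_int)
    then show ?thesis using pow_double[OF g(1), of "nat k"] by metis
  next
    case False
    have "s = inv s" using inv_equality[OF s_square] by simp
    also have "\<dots> = (g \<otimes> g) [^] nat (- k)" using k False g(1) by (simp add: int_pow_neg flip: int_pow_int)
    finally show ?thesis using pow_double[OF g(1), of "nat (- k)"] by metis
  qed
qed

text \<open>In the quotient by the annihilator of a nonzero \<open>w\<close>, the generators \<open>a\<close> and \<open>b\<close> of the quaternion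
  subgroup satisfy Hamilton's relations and \<open>x\<^sup>2 + y\<^sup>2 + z\<^sup>2 + 1 = 0\<close>.\<close>
lemma three_squares_anisotropic:
  assumes w: "w \<in> funs" "\<And>x y. x \<in> carrier G \<Longrightarrow> y \<in> carrier G \<Longrightarrow> w (x \<otimes> y) = w (y \<otimes> x)"
    and ws: "\<And>x. x \<in> carrier G \<Longrightarrow> w (s \<otimes> x) = \<ominus>\<^bsub>R\<^esub> w x"
    and cen: "x \<in> ring_center RG" "y \<in> ring_center RG" "z \<in> ring_center RG"
    and sum: "(x \<otimes>\<^bsub>RG\<^esub> x \<oplus>\<^bsub>RG\<^esub> y \<otimes>\<^bsub>RG\<^esub> y \<oplus>\<^bsub>RG\<^esub> z \<otimes>\<^bsub>RG\<^esub> z \<oplus>\<^bsub>RG\<^esub> \<one>\<^bsub>RG\<^esub>) \<otimes>\<^bsub>RG\<^esub> w = \<zero>\<^bsub>RG\<^esub>"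
  shows "w = \<zero>\<^bsub>RG\<^esub>"
proof (rule ccontr)
  assume nz: "w \<noteq> \<zero>\<^bsub>RG\<^esub>"
  obtain T \<theta> where q: "annihilator_quotient w T \<theta>"
    using annihilator_quotient_exists[OF clean two w nz] by blast
  then have T: "ring_hom_ring RG T \<theta>" "\<theta> ` carrier RG = carrier T" "idempotents_central T"
    "\<one>\<^bsub>T\<^esub> \<oplus>\<^bsub>T\<^esub> \<one>\<^bsub>T\<^esub> \<in> Units T" "\<one>\<^bsub>T\<^esub> \<noteq> \<zero>\<^bsub>T\<^esub>"
    and eq: "\<And>f h. f \<in> carrier RG \<Longrightarrow> h \<in> carrier RG \<Longrightarrow> f \<otimes>\<^bsub>RG\<^esub> w = h \<otimes>\<^bsub>RG\<^esub> w \<Longrightarrow> \<theta> f = \<theta> h"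
    unfolding annihilator_quotient_def by blast+
  note neg = annihilator_quotient_s[OF q w(1) ws]
  interpret \<theta>: ring_hom_ring RG T \<theta> by fact
  obtain a b where ab: "a \<in> carrier G" "b \<in> carrier G" "a \<otimes> a = s" "b \<otimes> b = s" "a \<otimes> b = s \<otimes> (b \<otimes> a)"
    using quaternion_generators .
  have mult: "\<theta> (emb x) \<otimes>\<^bsub>T\<^esub> \<theta> (emb y) = \<theta> (emb (x \<otimes> y))" if "x \<in> carrier G" "y \<in> carrier G" for x y
    using that by (simp add: monom_closed emb_mult flip: \<theta>.hom_mult)
  have s1: "\<theta> (emb s) = \<ominus>\<^bsub>T\<^esub> \<one>\<^bsub>T\<^esub>" using neg[of \<one>] by (simp flip: one_eq_monom)
  have ba: "b \<otimes> a = s \<otimes> (a \<otimes> b)" using ab by (simp add: s_cancel)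
  have \<theta>cen: "\<theta> c \<in> carrier T" "\<And>t. t \<in> carrier T \<Longrightarrow> t \<otimes>\<^bsub>T\<^esub> \<theta> c = \<theta> c \<otimes>\<^bsub>T\<^esub> t"
    if c: "c \<in> ring_center RG" for c
  proof -
    show "\<theta> c \<in> carrier T" using c by (simp add: ring_center_def)
    fix t assume "t \<in> carrier T"
    then obtain f where "f \<in> carrier RG" "t = \<theta> f" using T(2) by (metis imageE)
    then show "t \<otimes>\<^bsub>T\<^esub> \<theta> c = \<theta> c \<otimes>\<^bsub>T\<^esub> t" using c by (simp add: ring_center_def flip: \<theta>.hom_mult)
  qed
  have xyz: "x \<in> carrier RG" "y \<in> carrier RG" "z \<in> carrier RG" using cen by (auto simp: ring_center_def)
  have "\<theta> (x \<otimes>\<^bsub>RG\<^esub> x \<oplus>\<^bsub>RG\<^esub> y \<otimes>\<^bsub>RG\<^esub> y \<oplus>\<^bsub>RG\<^esub> z \<otimes>\<^bsub>RG\<^esub> z \<oplus>\<^bsub>RG\<^esub> \<one>\<^bsub>RG\<^esub>) = \<theta> \<zero>\<^bsub>RG\<^esub>"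
    using xyz sum zero_mult[OF w(1)] by (intro eq) simp_all
  then have "\<one>\<^bsub>T\<^esub> = \<zero>\<^bsub>T\<^esub>"
    using xyz ab neg[of "a \<otimes> b"] s1 ba
    by (intro \<theta>.S.quaternions_three_squares_trivial[OF T(4,3) _ _ _ _ _
          \<theta>cen[OF cen(1)] \<theta>cen[OF cen(2)] \<theta>cen[OF cen(3)], of "\<theta> (emb a)" "\<theta> (emb b)"])
      (simp_all add: monom_closed mult)
  then show False using T(5) by simp
qed

lemma trivial_subgroup_facts: "subgroup {\<one>} G" "s \<notin> {\<one>}" "{\<one>} \<subseteq> Z"
  using triv_subgroup s_not_one subgroup.one_closed[OF subgroup_center] by auto

lemma three_squares_base_ring:
  assumes "x \<in> carrier R" "y \<in> carrier R" "z \<in> carrier R"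
  shows "x \<otimes>\<^bsub>R\<^esub> x \<oplus>\<^bsub>R\<^esub> y \<otimes>\<^bsub>R\<^esub> y \<oplus>\<^bsub>R\<^esub> z \<otimes>\<^bsub>R\<^esub> z \<oplus>\<^bsub>R\<^esub> \<one>\<^bsub>R\<^esub> \<noteq> \<zero>\<^bsub>R\<^esub>"
proof
  assume sum: "x \<otimes>\<^bsub>R\<^esub> x \<oplus>\<^bsub>R\<^esub> y \<otimes>\<^bsub>R\<^esub> y \<oplus>\<^bsub>R\<^esub> z \<otimes>\<^bsub>R\<^esub> z \<oplus>\<^bsub>R\<^esub> \<one>\<^bsub>R\<^esub> = \<zero>\<^bsub>R\<^esub>"
  note N = trivial_subgroup_facts
  have one: "\<one> \<in> Z" using N(3) by simp
  have "(monom x \<one> \<otimes>\<^bsub>RG\<^esub> monom x \<one> \<oplus>\<^bsub>RG\<^esub> monom y \<one> \<otimes>\<^bsub>RG\<^esub> monom y \<one> \<oplus>\<^bsub>RG\<^esub>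
      monom z \<one> \<otimes>\<^bsub>RG\<^esub> monom z \<one> \<oplus>\<^bsub>RG\<^esub> \<one>\<^bsub>RG\<^esub>) = monom \<zero>\<^bsub>R\<^esub> \<one>"
    using assms by (simp add: monom_mult_monom one_eq_monom monom_add sum)
  also have "\<dots> = \<zero>\<^bsub>RG\<^esub>"
    by (rule funs_eqI) (simp_all add: monom_apply zero_apply carrier_funs monom_closed zero_closed)
  finally have "signed_indicator {\<one>} = \<zero>\<^bsub>RG\<^esub>"
    using three_squares_anisotropic[OF signed_indicator_funs signed_indicator_commute[OF N(3)]
        signed_indicator_s[OF N(1,2)], of "monom x \<one>" "monom y \<one>" "monom z \<one>"]
      monom_center[OF _ one] assms zero_mult[OF signed_indicator_funs] by simp
  then show False using signed_indicator_nonzero[OF N(1)] by blast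
qed

text \<open>The elements \<open>x, y\<close> with \<open>(1 - d\<^sup>2) (x\<^sup>2 + y\<^sup>2 + 1) = 0\<close> are found in the center of the group ring, a
  commutative ring. The anisotropy of three squares, with third entry \<open>0\<close>, then
  makes \<open>w = (1 - d\<^sup>2) (1 - s)\<close> vanish, but its coefficient at \<open>1\<close> is \<open>1\<close> unless \<open>d\<^sup>2\<close> is \<open>1\<close> or \<open>s\<close>, and
  \<open>s\<close> is not a central square.\<close>
lemma center_pow_two_pow_plus_one:
  assumes d: "d \<in> Z" "d [^] (2 ^ n + 1 :: nat) = \<one>"
  shows "d \<otimes> d = \<one>"
proof (rule ccontr)
  assume contr: "d \<otimes> d \<noteq> \<one>"
  note N = trivial_subgroup_facts
  have dc: "d \<in> carrier G" and ddZ: "d \<otimes> d \<in> Z"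
    using d centerD(1) square_center by auto
  define C where "C = RG\<lparr>carrier := ring_center RG\<rparr>"
  interpret C: cring C unfolding C_def by (rule RG.subcring_iff[THEN iffD1, OF _ RG.subcring_center]) (auto simp: ring_center_def)
  have pow: "emb d [^]\<^bsub>C\<^esub> k = emb (d [^] k)" for k :: nat
    using dc by (induction k) (simp_all add: C_def one_eq_monom emb_mult)
  obtain x y where xy: "x \<in> ring_center RG" "y \<in> ring_center RG"
    "(emb d \<otimes>\<^bsub>RG\<^esub> emb d) \<otimes>\<^bsub>RG\<^esub> (x \<otimes>\<^bsub>RG\<^esub> x \<oplus>\<^bsub>RG\<^esub> y \<otimes>\<^bsub>RG\<^esub> y \<oplus>\<^bsub>RG\<^esub> \<one>\<^bsub>RG\<^esub>)
      = x \<otimes>\<^bsub>RG\<^esub> x \<oplus>\<^bsub>RG\<^esub> y \<otimes>\<^bsub>RG\<^esub> y \<oplus>\<^bsub>RG\<^esub> \<one>\<^bsub>RG\<^esub>"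
    using C.minus_one_two_squares[of "emb d" n] monom_center[OF R.one_closed d(1)] pow[of "2 ^ n + 1"] d(2)
    by (auto simp: C_def one_eq_monom)
  define t where "t = x \<otimes>\<^bsub>RG\<^esub> x \<oplus>\<^bsub>RG\<^esub> y \<otimes>\<^bsub>RG\<^esub> y \<oplus>\<^bsub>RG\<^esub> \<one>\<^bsub>RG\<^esub>"
  have xyc: "x \<in> carrier RG" "y \<in> carrier RG" using xy(1,2) by (simp_all add: ring_center_def)
  then have t: "t \<in> carrier RG" by (simp add: t_def)
  \<comment> \<open>In the notation above, \<open>w0 = 1 - s\<close> and \<open>v = 1 - d\<^sup>2\<close>.\<close>
  define w0 where "w0 = signed_indicator {\<one>}"
  define v where "v = emb \<one> \<oplus>\<^bsub>RG\<^esub> monom (\<ominus>\<^bsub>R\<^esub> \<one>\<^bsub>R\<^esub>) (d \<otimes> d)"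
  define w where "w = v \<otimes>\<^bsub>RG\<^esub> w0"
  have w0: "w0 \<in> funs" by (simp add: w0_def signed_indicator_funs)
  have v: "v \<in> carrier RG" using dc by (simp add: v_def monom_closed)
  define e where "e = inv (d \<otimes> d)"
  have e: "e \<in> carrier G" "e \<in> Z" using dc ddZ subgroup.m_inv_closed[OF subgroup_center] by (auto simp: e_def)
  have w_apply: "w x = w0 x \<ominus>\<^bsub>R\<^esub> w0 (e \<otimes> x)" if "x \<in> carrier G" for x
    using that w0 dc e funs_closed[OF w0]
    by (simp add: w_def v_def mult_add_left monom_closed add_apply monom_mult_apply e_def[symmetric]
        R.l_minus R.minus_eq)
  have D: "emb (d \<otimes> d) \<in> carrier RG" by (simp add: monom_closed)
  have "monom (\<ominus>\<^bsub>R\<^esub> \<one>\<^bsub>R\<^esub>) (d \<otimes> d) \<oplus>\<^bsub>RG\<^esub> emb (d \<otimes> d) = \<zero>\<^bsub>RG\<^esub>"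
    by (rule funs_eqI) (simp_all add: add_apply monom_apply zero_apply monom_closed carrier_funs
        zero_closed add_closed R.l_neg)
  then have v_eq: "v = \<one>\<^bsub>RG\<^esub> \<ominus>\<^bsub>RG\<^esub> emb (d \<otimes> d)"
    using RG.minus_equality[OF _ D] by (simp add: v_def RG.minus_eq one_eq_monom monom_closed)
  have "t \<otimes>\<^bsub>RG\<^esub> emb (d \<otimes> d) = emb (d \<otimes> d) \<otimes>\<^bsub>RG\<^esub> t"
    using monom_center[OF R.one_closed ddZ] t by (simp add: ring_center_def)
  also have "\<dots> = t" using xy(3) dc by (simp add: t_def emb_mult)
  finally have vt: "t \<otimes>\<^bsub>RG\<^esub> v = \<zero>\<^bsub>RG\<^esub>"
    using t D by (simp add: v_eq RG.minus_eq RG.r_distr RG.r_minus RG.r_neg)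
  have tw: "t \<otimes>\<^bsub>RG\<^esub> w = \<zero>\<^bsub>RG\<^esub>"
    using vt mult_assoc[OF t v w0] zero_mult[OF w0] by (simp add: w_def)
  note w0_commute = signed_indicator_commute[OF N(3), folded w0_def]
  note w0_s = signed_indicator_s[OF N(1,2), folded w0_def]
  have "w = \<zero>\<^bsub>RG\<^esub>"
  proof (rule three_squares_anisotropic)
    show "w \<in> funs" using v w0 by (simp add: w_def mult_funs carrier_funs)
    show "w (x \<otimes> y) = w (y \<otimes> x)" if xy: "x \<in> carrier G" "y \<in> carrier G" for x y
    proof -
      have "w0 (e \<otimes> (x \<otimes> y)) = w0 (y \<otimes> (e \<otimes> x))"
        using w0_commute[of "e \<otimes> x" y] xy e by (simp add: m_assoc)
      also have "y \<otimes> (e \<otimes> x) = e \<otimes> (y \<otimes> x)" using centerD(2)[OF e(2) xy(2)] xy e by (metis m_assoc)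
      finally show ?thesis using w_apply w0_commute[OF xy] xy by simp
    qed
    show "w (s \<otimes> x) = \<ominus>\<^bsub>R\<^esub> w x" if x: "x \<in> carrier G" for x
    proof -
      have "e \<otimes> (s \<otimes> x) = s \<otimes> (e \<otimes> x)" using s_comm[OF e(1)] x e by (metis m_assoc s_closed)
      then show ?thesis
        using w_apply x w0_s e funs_closed[OF w0] by (simp add: R.minus_eq R.minus_add)
    qed
    show "x \<in> ring_center RG" "y \<in> ring_center RG" by fact+
    show "\<zero>\<^bsub>RG\<^esub> \<in> ring_center RG" by (simp add: ring_center_def)
    show "(x \<otimes>\<^bsub>RG\<^esub> x \<oplus>\<^bsub>RG\<^esub> y \<otimes>\<^bsub>RG\<^esub> y \<oplus>\<^bsub>RG\<^esub> \<zero>\<^bsub>RG\<^esub> \<otimes>\<^bsub>RG\<^esub> \<zero>\<^bsub>RG\<^esub> \<oplus>\<^bsub>RG\<^esub> \<one>\<^bsub>RG\<^esub>) \<otimes>\<^bsub>RG\<^esub> w = \<zero>\<^bsub>RG\<^esub>"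
      using tw xyc by (simp add: t_def)
  qed
  moreover have "w \<one> = \<one>\<^bsub>R\<^esub>"
  proof -
    have "e \<noteq> \<one>" using contr dc by (metis e_def inv_inv inv_one m_closed)
    moreover have "s \<otimes> e \<noteq> \<one>"
    proof
      assume "s \<otimes> e = \<one>"
      then have "s = d \<otimes> d" using dc inv_equality[of s e] e by (simp add: e_def)
      then show False using center_not_square[OF d(1)] by simp
    qed
    ultimately have "w0 e = \<zero>\<^bsub>R\<^esub>" using e by (simp add: w0_def signed_indicator_def)
    then show ?thesis
      using w_apply[of \<one>] signed_indicator_one[OF N(1)] e by (simp add: w0_def R.minus_eq)
  qed
  ultimately show False using zero_apply[of \<one>] nontrivial by simp
qed

end

theorem theoremA:
  fixes G :: "('g, 'm) monoid_scheme" and R :: "('r, 'n) ring_scheme"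
  assumes "SLC_group G"
    and "cring R"
    and "\<one>\<^bsub>R\<^esub> \<noteq> \<zero>\<^bsub>R\<^esub>"
    and "\<one>\<^bsub>R\<^esub> \<oplus>\<^bsub>R\<^esub> \<one>\<^bsub>R\<^esub> \<in> Units R"
    and "star_clean (group_ring R G) (linear_extension R G (canonical_involution G))"
  shows "(\<exists>A :: 'g monoid. comm_group A \<and> G \<cong> (Q8 \<times>\<times> A) \<and>
            (\<forall>a\<in>carrier A. group.ord A a \<noteq> 4) \<and>
            (\<forall>p::nat. Factorial_Ring.prime p \<and> (\<exists>n::nat. n > 0 \<and> p dvd 2 ^ n + 1) \<longrightarrow>
               (\<forall>a\<in>carrier A. group.ord A a \<noteq> p))) \<and>
         \<not> (\<exists>x\<in>carrier R. \<exists>y\<in>carrier R. \<exists>z\<in>carrier R.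
              x [^]\<^bsub>R\<^esub> (2::nat) \<oplus>\<^bsub>R\<^esub> y [^]\<^bsub>R\<^esub> (2::nat) \<oplus>\<^bsub>R\<^esub> z [^]\<^bsub>R\<^esub> (2::nat) \<oplus>\<^bsub>R\<^esub> \<one>\<^bsub>R\<^esub>
                = \<zero>\<^bsub>R\<^esub>)"
proof -
  interpret SLC_algebra G R
    using assms(1,2) by (simp add: SLC_algebra_def SLC_def SLC_axioms_def group_algebra_def SLC_group_def)
  interpret clean_SLC_algebra G R
    using star_clean_imp_centrally_clean[OF assms(5)] assms(3,4) by unfold_locales
  obtain a b where ab: "a \<in> carrier G" "b \<in> carrier G" "a \<otimes>\<^bsub>G\<^esub> a = s" "b \<otimes>\<^bsub>G\<^esub> b = s"
      "a \<otimes>\<^bsub>G\<^esub> b = s \<otimes>\<^bsub>G\<^esub> (b \<otimes>\<^bsub>G\<^esub> a)"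
    using quaternion_generators .
  obtain A where A: "subgroup A G" "A \<subseteq> Z" "s \<notin> A" "\<And>z. z \<in> Z \<Longrightarrow> z \<in> A \<or> s \<otimes>\<^bsub>G\<^esub> z \<in> A"
    using center_complement by metis
  define M where "M = subgroup_monoid G A"
  interpret M: group M unfolding M_def by (rule group_subgroup_monoid[OF A(1)])
  have M: "carrier M = A" "monoid.mult M = monoid.mult G" "\<one>\<^bsub>M\<^esub> = \<one>\<^bsub>G\<^esub>"
    by (simp_all add: M_def subgroup_monoid_def)
  have pow: "x [^]\<^bsub>M\<^esub> (n::nat) = x [^]\<^bsub>G\<^esub> n" for x n unfolding M_def by (rule pow_subgroup_monoid)
  have "comm_group M"
    using centerD A(2) by (intro M.group_comm_groupI) (auto simp: M subset_iff)
  moreover have "G \<cong> Q8 \<times>\<times> M"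
    unfolding M_def using iso_Q8_times_complement[OF ab A] by blast
  moreover have "M.ord x \<noteq> 4" if x: "x \<in> carrier M" for x
  proof
    assume o: "M.ord x = 4"
    have "x [^]\<^bsub>G\<^esub> (4::nat) = \<one>\<^bsub>G\<^esub>" using M.pow_ord_eq_1[OF x] unfolding o pow M .
    then have "x \<otimes>\<^bsub>G\<^esub> x = \<one>\<^bsub>G\<^esub>" using center_no_order_four x A(2) M by auto
    then have "x [^]\<^bsub>M\<^esub> (2::nat) = \<one>\<^bsub>M\<^esub>" using x subgroup.mem_carrier[OF A(1)] by (simp add: pow M numeral_2_eq_2)
    then have "4 dvd (2::nat)" using M.pow_eq_id[OF x, of 2] o by simp
    then show False by simp
  qed
  moreover have "M.ord x \<noteq> p"
    if p: "Factorial_Ring.prime p" "n > 0" "p dvd 2 ^ n + 1" and x: "x \<in> carrier M" for p n :: nat and x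
  proof
    assume o: "M.ord x = p"
    have "x [^]\<^bsub>M\<^esub> (2 ^ n + 1 :: nat) = \<one>\<^bsub>M\<^esub>" 
      using M.pow_eq_id[OF x, of "2 ^ n + 1"] p(3) unfolding o by (rule iffD2)
    then have "x \<otimes>\<^bsub>G\<^esub> x = \<one>\<^bsub>G\<^esub>"
      using center_pow_two_pow_plus_one[of x n] x A(2) unfolding pow M by blast
    then have "x [^]\<^bsub>M\<^esub> (2::nat) = \<one>\<^bsub>M\<^esub>"
      using x subgroup.mem_carrier[OF A(1)] by (simp add: pow M numeral_2_eq_2)
    then have "p dvd 2" using M.pow_eq_id[OF x, of 2] o by simp
    then have "p = 2" using p(1) by (metis primes_dvd_imp_eq two_is_prime_nat)
    then show False using p(2,3) by simp
  qed
  moreover have "x [^]\<^bsub>R\<^esub> (2::nat) \<oplus>\<^bsub>R\<^esub> y [^]\<^bsub>R\<^esub> (2::nat) \<oplus>\<^bsub>R\<^esub> z [^]\<^bsub>R\<^esub> (2::nat) \<oplus>\<^bsub>R\<^esub> \<one>\<^bsub>R\<^esub> \<noteq> \<zero>\<^bsub>R\<^esub>"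
    if "x \<in> carrier R" "y \<in> carrier R" "z \<in> carrier R" for x y z
    using three_squares_base_ring[OF that] that by (simp add: numeral_2_eq_2)
  ultimately show ?thesis by blast
qed

end
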